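(* If $$F(S_1,\ldots,S_n):=\sum_{k=0}^\infty\sum_{|\alpha|=k}S_\alpha\otimes A_{(\alpha)},\quad A_{(\alpha)}\in B(\mathcal{H}),$$ is in $F_n^\infty\bar\otimes B(\mathcal{H})$ and such that $F(0)\geq0$ and $\mathrm{Re}\,F(S_1,\ldots,S_n)\leq I$, then $$\left\|\sum_{|\alpha|=k}A_{(\alpha)}^*A_{(\alpha)}\right\|^{1/2}\leq2\|I-A_{(0)}\|\quad\text{for }k=1,2,\ldots,$$ and $$\sum_{k=0}^\infty\left\|\sum_{|\alpha|=k}T_\alpha\otimes A_{(\alpha)}\right\|\leq\|A_{(0)}\|+\|I-A_{(0)}\|$$ for any $n$-tuple of bounded operators $(T_1,\ldots,T_n)\in[B(\mathcal{K})^n]_{1/3}$, i.e. $\|T_1T_1^*+\cdots+T_nT_n^*\|^{1/2}\leq\frac13$, on any Hilbert space $\mathcal{K}$.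
   Context: $H_n$ is an $n$-dimensional complex Hilbert space with orthonormal basis $e_1,\dots,e_n$; $F^2(H_n)=\bigoplus_{k\ge0}H_n^{\otimes k}$ (with $H_n^{\otimes0}=\mathbb{C}1$) is the full Fock space and $S_i\varphi=e_i\otimes\varphi$, $i=1,\dots,n$, are the left creation operators. The noncommutative analytic Toeplitz algebra $F_n^\infty$ is the WOT-closed (equivalently $w^*$-closed) algebra generated by $S_1,\dots,S_n$ and the identity; $F_n^\infty\bar\otimes B(\mathcal{H})$ is the WOT-closed algebra generated by the spatial tensor product. $\mathbb{F}_n^+$ is the unital free semigroup on $g_1,\dots,g_n$ with identity $g_0$; $|g_{i_1}\cdots g_{i_k}|=k$, $|g_0|=0$; for $\alpha=g_{i_1}\cdots g_{i_k}$, $T_\alpha:=T_{i_1}\cdots T_{i_k}$, $T_{g_0}:=I$, $e_\alpha:=e_{i_1}\otimes\cdots\otimes e_{i_k}$, $e_{g_0}:=1$. An element $F$ of $F_n^\infty\bar\otimes B(\mathcal{H})$ has uniquely determined coefficients $A_{(\alpha)}\in B(\mathcal{H})$, given by $\langle A_{(\alpha)}h,h'\rangle=\langle F(1\otimes h),e_\alpha\otimes h'\rangle$, and is identified with its formal Fourier expansion $\sum_{k}\sum_{|\alpha|=k}S_\alpha\otimes A_{(\alpha)}$; one has $F=\text{SOT-}\lim_{r\to1}\sum_{k=0}^\infty\sum_{|\alpha|=k}r^{|\alpha|}S_\alpha\otimes A_{(\alpha)}$, each series converging in norm for $0\le r<1$. $A_{(0)}:=A_{(g_0)}$, $F(0)\ge0$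 means $A_{(0)}\ge0$; $\mathrm{Re}\,A=\frac12(A+A^* )$. *)

theory Defs
  imports "HOL-Analysis.Analysis"
begin

section \<open>Complex Hilbert spaces\<close>

class scaleC =
  fixes scaleC :: "complex \<Rightarrow> 'a \<Rightarrow> 'a" (infixr "*\<^sub>C" 75)

text \<open>The inner product is linear in the first and conjugate-linear in the second argument.
  Norm, distance and topology come from \<^class>\<open>real_inner\<close>.\<close>

class complex_inner = real_inner + scaleC +
  fixes cinner :: "'a \<Rightarrow> 'a \<Rightarrow> complex"
  assumes scaleR_scaleC: "scaleR r x = scaleC (complex_of_real r) x"
    and scaleC_add_right: "scaleC c (x + y) = scaleC c x + scaleC c y"
    and scaleC_add_left: "scaleC (c + d) x = scaleC c x + scaleC d x"
    and scaleC_scaleC [simp]: "scaleC c (scaleC d x) = scaleC (c * d) x"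
    and cinner_commute: "cinner x y = cnj (cinner y x)"
    and cinner_add_left: "cinner (x + y) z = cinner x z + cinner y z"
    and cinner_scaleC_left [simp]: "cinner (scaleC c x) y = c * cinner x y"
    and inner_eq_Re_cinner: "inner x y = Re (cinner x y)"

class chilbert_space = complex_inner + complete_space

instance chilbert_space \<subseteq> banach ..

instantiation complex :: chilbert_space
begin

definition scaleC_complex :: "complex \<Rightarrow> complex \<Rightarrow> complex" where
  "scaleC_complex c z = c * z"

definition cinner_complex :: "complex \<Rightarrow> complex \<Rightarrow> complex" where
  "cinner_complex z w = z * cnj w"

instance
  by standard
    (auto simp: scaleC_complex_def cinner_complex_def inner_complex_def algebra_simps
      scaleR_conv_of_real)

end

context complex_inner
begin

lemma scaleC_one [simp]: "1 *\<^sub>C x = x"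
  using scaleR_scaleC[of 1 x] by (simp only: of_real_1 local.scaleR_one)

lemma scaleC_zero_left [simp]: "0 *\<^sub>C x = 0"
  using scaleC_add_left[of 0 0 x] by simp

lemma scaleC_zero_right [simp]: "c *\<^sub>C 0 = 0"
  using scaleC_add_right[of c 0 0] by simp

lemma scaleC_minus_left [simp]: "(- c) *\<^sub>C x = - (c *\<^sub>C x)"
  using scaleC_add_left[of c "- c" x] by (simp add: minus_unique)

lemma scaleC_minus_right [simp]: "c *\<^sub>C (- x) = - (c *\<^sub>C x)"
  using scaleC_add_right[of c x "- x"] by (simp add: minus_unique)

lemma scaleC_diff_right: "c *\<^sub>C (x - y) = c *\<^sub>C x - c *\<^sub>C y"
  using scaleC_add_right[of c x "- y"] by simp

lemma cinner_add_right: "cinner x (y + z) = cinner x y + cinner x z"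
  by (metis cinner_commute cinner_add_left complex_cnj_add)

lemma cinner_scaleC_right [simp]: "cinner x (c *\<^sub>C y) = cnj c * cinner x y"
  by (metis cinner_commute cinner_scaleC_left complex_cnj_mult)

lemma cinner_zero_left [simp]: "cinner 0 y = 0"
  using cinner_scaleC_left[of 0 0 y] by simp

lemma cinner_zero_right [simp]: "cinner x 0 = 0"
  using cinner_scaleC_right[of x 0 0] by simp

lemma cinner_minus_left [simp]: "cinner (- x) y = - cinner x y"
  using cinner_scaleC_left[of "-1" x y] by simp

lemma cinner_minus_right [simp]: "cinner x (- y) = - cinner x y"
  using cinner_scaleC_right[of x "-1" y] by simp

lemma cinner_diff_left: "cinner (x - y) z = cinner x z - cinner y z"
  using cinner_add_left[of x "- y" z] by simp

lemma cinner_diff_right: "cinner x (y - z) = cinner x y - cinner x z"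
  using cinner_add_right[of x y "- z"] by simp

lemma cinner_sum_left: "cinner (\<Sum>i\<in>I. f i) y = (\<Sum>i\<in>I. cinner (f i) y)"
  by (induction I rule: infinite_finite_induct) (auto simp: cinner_add_left)

lemma cinner_sum_right: "cinner x (\<Sum>i\<in>I. f i) = (\<Sum>i\<in>I. cinner x (f i))"
  by (induction I rule: infinite_finite_induct) (auto simp: cinner_add_right)

end

lemma cinner_self: "cinner x x = complex_of_real ((norm x)\<^sup>2)"
  for x :: "'a::complex_inner"
proof (rule complex_eqI)
  show "Re (cinner x x) = Re (complex_of_real ((norm x)\<^sup>2))"
    by (simp add: inner_eq_Re_cinner[symmetric] power2_norm_eq_inner del: of_real_power)
  show "Im (cinner x x) = Im (complex_of_real ((norm x)\<^sup>2))"
    using arg_cong[OF cinner_commute[of x x], of Im] by (simp del: of_real_power)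
qed

lemma norm_scaleC [simp]: "norm (c *\<^sub>C x) = cmod c * norm x"
  for x :: "'a::complex_inner"
proof -
  have "complex_of_real ((norm (c *\<^sub>C x))\<^sup>2) = complex_of_real ((cmod c * norm x)\<^sup>2)"
    by (simp add: cinner_self[symmetric] power_mult_distrib complex_norm_square mult.assoc
        del: of_real_power) (simp add: cinner_self complex_norm_square[unfolded of_real_power] mult.commute)
  then have "(norm (c *\<^sub>C x))\<^sup>2 = (cmod c * norm x)\<^sup>2"
    by (metis of_real_eq_iff)
  then show ?thesis
    by (simp add: power2_eq_iff_nonneg)
qed

lemma cmod_cinner_le: "cmod (cinner x y) \<le> norm x * norm y"
  for x y :: "'a::complex_inner"
proof (cases "cinner x y = 0")
  case False
  define c where "c = cnj (cinner x y) / cmod (cinner x y)"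
  have c: "cmod c = 1"
    using False by (simp add: c_def norm_divide)
  have "cinner (c *\<^sub>C x) y = cmod (cinner x y)"
    using False by (simp add: c_def complex_norm_square[symmetric] power2_eq_square field_simps)
  then have "cmod (cinner x y) = inner (c *\<^sub>C x) y"
    by (simp add: inner_eq_Re_cinner)
  also have "\<dots> \<le> norm (c *\<^sub>C x) * norm y"
    by (rule norm_cauchy_schwarz)
  finally show ?thesis
    by (simp add: c)
qed simp

lemma cinner_ext: "(\<And>z. cinner x z = cinner y z) \<Longrightarrow> x = y"
  for x y :: "'a::complex_inner"
  by (metis cinner_diff_left cinner_self eq_iff_diff_eq_0 norm_eq_zero of_real_eq_0_iff
      zero_eq_power2)

lemma cinner_ext_right: "(\<And>z. cinner z x = cinner z y) \<Longrightarrow> x = y"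
  for x y :: "'a::complex_inner"
  by (rule cinner_ext) (simp only: cinner_commute[of x] cinner_commute[of y])

lemma bounded_bilinear_cinner:
  "bounded_bilinear (cinner :: 'a::complex_inner \<Rightarrow> 'a \<Rightarrow> complex)"
proof
  show "\<exists>K. \<forall>(a::'a) b. cmod (cinner a b) \<le> norm a * norm b * K"
    by (rule exI[of _ 1]) (simp add: cmod_cinner_le)
qed (simp_all add: cinner_add_left cinner_add_right scaleR_scaleC scaleC_complex_def)

lemma bounded_linear_scaleC: "bounded_linear (\<lambda>x::'a::complex_inner. c *\<^sub>C x)"
  by (rule bounded_linear_intro[where K = "cmod c"])
    (simp_all add: scaleC_add_right scaleR_scaleC mult.commute)

interpretation complex_vector: vector_space "scaleC :: complex \<Rightarrow> 'a \<Rightarrow> 'a::complex_inner"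
  by standard (simp_all add: scaleC_add_left scaleC_add_right)

abbreviation cspan :: "'a::complex_inner set \<Rightarrow> 'a set" where
  "cspan \<equiv> module.span scaleC"

section \<open>Square-summable families\<close>

typedef (overloaded) ('i, 'h) ell2 =
  "{f :: 'i \<Rightarrow> 'h::complex_inner. (\<lambda>i. (norm (f i))\<^sup>2) summable_on UNIV}"
  by (rule exI[of _ "\<lambda>_. 0"]) simp

setup_lifting type_definition_ell2

lemma square_summable_add:
  assumes "(\<lambda>i. (norm (f i))\<^sup>2) summable_on UNIV" "(\<lambda>i. (norm (g i))\<^sup>2) summable_on UNIV"
  shows "(\<lambda>i. (norm (f i + g i :: 'h::complex_inner))\<^sup>2) summable_on UNIV"
proof (rule summable_on_comparison_test)
  show "(\<lambda>i. 2 * (norm (f i))\<^sup>2 + 2 * (norm (g i))\<^sup>2) summable_on UNIV"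
    by (intro summable_on_add summable_on_cmult_right assms)
  show "(norm (f i + g i))\<^sup>2 \<le> 2 * (norm (f i))\<^sup>2 + 2 * (norm (g i))\<^sup>2" for i
  proof -
    have "(norm (f i + g i))\<^sup>2 \<le> (norm (f i) + norm (g i))\<^sup>2"
      by (intro power_mono norm_triangle_ineq) simp
    moreover have "0 \<le> (norm (f i) - norm (g i))\<^sup>2"
      by simp
    ultimately show ?thesis
      unfolding power2_sum power2_diff by linarith
  qed
qed simp_all

lemma square_summable_scaleC:
  assumes "(\<lambda>i. (norm (f i))\<^sup>2) summable_on UNIV"
  shows "(\<lambda>i. (norm (c *\<^sub>C f i :: 'h::complex_inner))\<^sup>2) summable_on UNIV"
  using summable_on_cmult_right[OF assms] by (simp add: power_mult_distrib)

lemma square_summable_cinner: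
  assumes "(\<lambda>i. (norm (f i))\<^sup>2) summable_on UNIV" "(\<lambda>i. (norm (g i))\<^sup>2) summable_on UNIV"
  shows "(\<lambda>i. cinner (f i) (g i :: 'h::complex_inner)) summable_on UNIV"
proof (rule abs_summable_summable, rule summable_on_comparison_test)
  show "(\<lambda>i. (norm (f i))\<^sup>2 + (norm (g i))\<^sup>2) summable_on UNIV"
    by (intro summable_on_add assms)
  show "cmod (cinner (f i) (g i)) \<le> (norm (f i))\<^sup>2 + (norm (g i))\<^sup>2" for i
  proof -
    have "2 * (norm (f i) * norm (g i)) \<le> (norm (f i))\<^sup>2 + (norm (g i))\<^sup>2"
      using zero_le_power2[of "norm (f i) - norm (g i)"] unfolding power2_diff by linarith
    then show ?thesis
      using cmod_cinner_le[of "f i" "g i"] mult_nonneg_nonneg[of "norm (f i)" "norm (g i)"]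
      by (smt (verit) norm_ge_zero)
  qed
qed simp_all

instantiation ell2 :: (type, complex_inner) complex_inner
begin

lift_definition zero_ell2 :: "('a, 'b) ell2" is "\<lambda>_. 0"
  by simp

lift_definition plus_ell2 :: "('a, 'b) ell2 \<Rightarrow> ('a, 'b) ell2 \<Rightarrow> ('a, 'b) ell2" is
  "\<lambda>f g i. f i + g i"
  by (rule square_summable_add)

lift_definition uminus_ell2 :: "('a, 'b) ell2 \<Rightarrow> ('a, 'b) ell2" is "\<lambda>f i. - f i"
  by simp

lift_definition minus_ell2 :: "('a, 'b) ell2 \<Rightarrow> ('a, 'b) ell2 \<Rightarrow> ('a, 'b) ell2" is
  "\<lambda>f g i. f i - g i"
  using square_summable_add[of _ "\<lambda>i. - _ i"] by simp

lift_definition scaleC_ell2 :: "complex \<Rightarrow> ('a, 'b) ell2 \<Rightarrow> ('a, 'b) ell2" is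
  "\<lambda>c f i. c *\<^sub>C f i"
  by (rule square_summable_scaleC)

lift_definition scaleR_ell2 :: "real \<Rightarrow> ('a, 'b) ell2 \<Rightarrow> ('a, 'b) ell2" is
  "\<lambda>r f i. r *\<^sub>R f i"
  using square_summable_scaleC[of _ "complex_of_real _"] by (simp add: scaleR_scaleC)

lift_definition cinner_ell2 :: "('a, 'b) ell2 \<Rightarrow> ('a, 'b) ell2 \<Rightarrow> complex" is
  "\<lambda>f g. \<Sum>\<^sub>\<infinity>i. cinner (f i) (g i)" .

definition inner_ell2 :: "('a, 'b) ell2 \<Rightarrow> ('a, 'b) ell2 \<Rightarrow> real" where
  "inner_ell2 f g = Re (cinner f g)"

definition norm_ell2 :: "('a, 'b) ell2 \<Rightarrow> real" where
  "norm_ell2 f = sqrt (inner f f)"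

definition sgn_ell2 :: "('a, 'b) ell2 \<Rightarrow> ('a, 'b) ell2" where
  "sgn_ell2 f = scaleR (inverse (norm f)) f"

definition dist_ell2 :: "('a, 'b) ell2 \<Rightarrow> ('a, 'b) ell2 \<Rightarrow> real" where
  "dist_ell2 f g = norm (f - g)"

definition uniformity_ell2 :: "(('a, 'b) ell2 \<times> ('a, 'b) ell2) filter" where
  "uniformity_ell2 = (INF e\<in>{0<..}. principal {(f, g). dist f g < e})"

definition open_ell2 :: "('a, 'b) ell2 set \<Rightarrow> bool" where
  "open_ell2 U = (\<forall>f\<in>U. eventually (\<lambda>(f', g). f' = f \<longrightarrow> g \<in> U) uniformity)"

lemma cinner_ell2_has_sum:
  "((\<lambda>i. cinner (Rep_ell2 f i) (Rep_ell2 g i)) has_sum cinner f g) UNIV"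
  for f g :: "('a, 'b) ell2"
  unfolding cinner_ell2.rep_eq
  by (rule has_sum_infsum, rule square_summable_cinner) (use Rep_ell2 in auto)

lemma cinner_self_ell2_has_sum:
  "((\<lambda>i. (norm (Rep_ell2 f i))\<^sup>2) has_sum Re (cinner f f)) UNIV"
  for f :: "('a, 'b) ell2"
  using has_sum_Re[OF cinner_ell2_has_sum[of f f]] by (simp add: cinner_self del: of_real_power)

instance
proof
  fix f g h :: "('a, 'b) ell2" and r s :: real and c d :: complex
  show "f + g + h = f + (g + h)" by transfer (simp add: add.assoc)
  show "f + g = g + f" by transfer (simp add: add.commute)
  show "0 + f = f" by transfer simp
  show "- f + f = 0" by transfer simp
  show "f - g = f + - g" by transfer simp
  show "r *\<^sub>R (f + g) = r *\<^sub>R f + r *\<^sub>R g" by transfer (simp add: scaleR_add_right)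
  show "(r + s) *\<^sub>R f = r *\<^sub>R f + s *\<^sub>R f" by transfer (simp add: scaleR_add_left)
  show "r *\<^sub>R s *\<^sub>R f = (r * s) *\<^sub>R f" by transfer simp
  show "1 *\<^sub>R f = f" by transfer simp
  show "r *\<^sub>R f = complex_of_real r *\<^sub>C f" by transfer (simp add: scaleR_scaleC)
  show "c *\<^sub>C (f + g) = c *\<^sub>C f + c *\<^sub>C g" by transfer (simp add: scaleC_add_right)
  show "(c + d) *\<^sub>C f = c *\<^sub>C f + d *\<^sub>C f" by transfer (simp add: scaleC_add_left)
  show "c *\<^sub>C d *\<^sub>C f = (c * d) *\<^sub>C f" by transfer simp
  show cinner_commute: "cinner f g = cnj (cinner g f)" for f g :: "('a, 'b) ell2"
    by transfer (subst infsum_cnj[symmetric], rule infsum_cong, rule cinner_commute)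
  show cinner_add: "cinner (f + g) h = cinner f h + cinner g h"
  proof (rule has_sum_unique[OF cinner_ell2_has_sum])
    show "((\<lambda>i. cinner (Rep_ell2 (f + g) i) (Rep_ell2 h i)) has_sum cinner f h + cinner g h) UNIV"
      using has_sum_add[OF cinner_ell2_has_sum[of f h] cinner_ell2_has_sum[of g h]]
      by (simp add: plus_ell2.rep_eq cinner_add_left)
  qed
  show cinner_scale: "cinner (c *\<^sub>C f) g = c * cinner f g" for c
  proof (rule has_sum_unique[OF cinner_ell2_has_sum])
    show "((\<lambda>i. cinner (Rep_ell2 (c *\<^sub>C f) i) (Rep_ell2 g i)) has_sum c * cinner f g) UNIV"
      using has_sum_cmult_right[OF cinner_ell2_has_sum[of f g], of c]
      by (simp add: scaleC_ell2.rep_eq)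
  qed
  show "f \<bullet> g = Re (cinner f g)" by (rule inner_ell2_def)
  show "f \<bullet> g = g \<bullet> f"
    using cinner_commute[of f g] by (simp add: inner_ell2_def)
  show "(f + g) \<bullet> h = f \<bullet> h + g \<bullet> h"
    by (simp add: inner_ell2_def cinner_add)
  have "r *\<^sub>R f = complex_of_real r *\<^sub>C f" by transfer (simp add: scaleR_scaleC)
  then show "r *\<^sub>R f \<bullet> g = r * (f \<bullet> g)"
    by (simp add: inner_ell2_def cinner_scale)
  show "0 \<le> f \<bullet> f"
    unfolding inner_ell2_def by (rule has_sum_nonneg[OF cinner_self_ell2_has_sum]) simp
  show "f \<bullet> f = 0 \<longleftrightarrow> f = 0"
  proof
    assume "f \<bullet> f = 0"
    then have "((\<lambda>i. (norm (Rep_ell2 f i))\<^sup>2) has_sum 0) UNIV"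
      using cinner_self_ell2_has_sum[of f] by (simp add: inner_ell2_def)
    then have "(norm (Rep_ell2 f i))\<^sup>2 = 0" for i
      by (rule nonneg_has_sum_le_0D) auto
    then show "f = 0"
      by transfer auto
  next
    show "f = 0 \<Longrightarrow> f \<bullet> f = 0"
      unfolding inner_ell2_def by transfer simp
  qed
  show "norm f = sqrt (f \<bullet> f)" by (rule norm_ell2_def)
  show "sgn f = scaleR (inverse (norm f)) f" by (rule sgn_ell2_def)
  show "dist f g = norm (f - g)" by (rule dist_ell2_def)
  show "uniformity = (INF e\<in>{0<..}. principal {(f :: ('a, 'b) ell2, g). dist f g < e})"
    by (rule uniformity_ell2_def)
  show "open U = (\<forall>f\<in>U. eventually (\<lambda>(f', g). f' = f \<longrightarrow> g \<in> U) uniformity)"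
    for U :: "('a, 'b) ell2 set"
    by (rule open_ell2_def)
qed

end

lemma norm_ell2_has_sum: "((\<lambda>i. (norm (Rep_ell2 f i))\<^sup>2) has_sum (norm f)\<^sup>2) UNIV"
  using cinner_self_ell2_has_sum[of f] by (simp add: cinner_self del: of_real_power)

lemma norm_Rep_ell2_le: "norm (Rep_ell2 f i) \<le> norm f"
  using finite_sum_le_has_sum[OF norm_ell2_has_sum[of f], of "{i}"]
  by (simp add: power_mono_iff)

lemma bounded_linear_Rep_ell2: "bounded_linear (\<lambda>f. Rep_ell2 f i)"
  by (rule bounded_linear_intro[where K = 1])
    (simp_all add: plus_ell2.rep_eq scaleR_ell2.rep_eq norm_Rep_ell2_le)

instance ell2 :: (type, chilbert_space) chilbert_space
proof
  fix X :: "nat \<Rightarrow> ('a, 'b) ell2"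
  assume X: "Cauchy X"
  have "Cauchy (\<lambda>n. Rep_ell2 (X n) i)" for i
    by (rule bounded_linear.Cauchy[OF bounded_linear_Rep_ell2 X])
  then have "\<exists>l. (\<lambda>n. Rep_ell2 (X n) i) \<longlonglongrightarrow> l" for i
    by (simp add: Cauchy_convergent_iff convergent_def)
  then obtain l where l: "\<And>i. (\<lambda>n. Rep_ell2 (X n) i) \<longlonglongrightarrow> l i"
    by metis
  have fin: "(\<Sum>i\<in>I. (norm (Rep_ell2 (X n) i - l i))\<^sup>2) \<le> e\<^sup>2"
    if I: "finite I" and M: "\<And>m n. m \<ge> M \<Longrightarrow> n \<ge> M \<Longrightarrow> dist (X m) (X n) < e" "n \<ge> M"
    for e M n I
  proof (rule tendsto_upperbound)
    show "(\<lambda>m. \<Sum>i\<in>I. (norm (Rep_ell2 (X n) i - Rep_ell2 (X m) i))\<^sup>2)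
        \<longlonglongrightarrow> (\<Sum>i\<in>I. (norm (Rep_ell2 (X n) i - l i))\<^sup>2)"
      by (intro tendsto_intros l)
    show "\<forall>\<^sub>F m in sequentially. (\<Sum>i\<in>I. (norm (Rep_ell2 (X n) i - Rep_ell2 (X m) i))\<^sup>2) \<le> e\<^sup>2"
      using eventually_ge_at_top[of M]
    proof eventually_elim
      case (elim m)
      have "(\<Sum>i\<in>I. (norm (Rep_ell2 (X n) i - Rep_ell2 (X m) i))\<^sup>2) \<le> (norm (X n - X m))\<^sup>2"
        using finite_sum_le_has_sum[OF norm_ell2_has_sum[of "X n - X m"] I]
        by (simp add: minus_ell2.rep_eq)
      also have "\<dots> \<le> e\<^sup>2"
        using M(1)[OF M(2) elim] by (intro power_mono) (simp_all add: dist_norm)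
      finally show ?case .
    qed
  qed simp
  obtain M1 where M1: "\<And>m n. m \<ge> M1 \<Longrightarrow> n \<ge> M1 \<Longrightarrow> dist (X m) (X n) < 1"
    using metric_CauchyD[OF X, of 1] by auto
  have "(\<lambda>i. (norm (Rep_ell2 (X M1) i - l i))\<^sup>2) summable_on UNIV"
  proof (rule nonneg_bdd_above_summable_on)
    show "bdd_above (sum (\<lambda>i. (norm (Rep_ell2 (X M1) i - l i))\<^sup>2) ` {F. F \<subseteq> UNIV \<and> finite F})"
      using fin[where e = 1, OF _ M1] by (intro bdd_aboveI2[where M = "1"]) auto
  qed simp
  then have "(\<lambda>i. (norm (Rep_ell2 (X M1) i + - (Rep_ell2 (X M1) i - l i)))\<^sup>2) summable_on UNIV"
    by (intro square_summable_add) (use Rep_ell2 in \<open>auto simp: norm_minus_commute\<close>)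
  then have L: "Rep_ell2 (Abs_ell2 l) = l"
    by (simp add: Abs_ell2_inverse)
  have "X \<longlonglongrightarrow> Abs_ell2 l"
  proof (rule metric_LIMSEQ_I)
    fix e :: real assume "e > 0"
    then obtain M where M: "\<And>m n. m \<ge> M \<Longrightarrow> n \<ge> M \<Longrightarrow> dist (X m) (X n) < e / 2"
      using metric_CauchyD[OF X, of "e / 2"] by auto
    have "dist (X n) (Abs_ell2 l) < e" if "n \<ge> M" for n
    proof -
      have "(norm (X n - Abs_ell2 l))\<^sup>2 \<le> (e / 2)\<^sup>2"
        using fin[where e = "e / 2", OF _ M that]
        by (intro has_sum_le_finite_sums[OF norm_ell2_has_sum]) (auto simp: minus_ell2.rep_eq L)
      then show ?thesis
        using \<open>e > 0\<close> by (simp add: dist_norm power2_le_iff_abs_le)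
    qed
    then show "\<exists>no. \<forall>n\<ge>no. dist (X n) (Abs_ell2 l) < e"
      by blast
  qed
  then show "convergent X"
    by (rule convergentI)
qed

section \<open>Orthonormal bases\<close>

definition orthonormal :: "'a::complex_inner set \<Rightarrow> bool" where
  "orthonormal B \<longleftrightarrow>
    (\<forall>b\<in>B. norm b = 1) \<and> (\<forall>b\<in>B. \<forall>c\<in>B. b \<noteq> c \<longrightarrow> cinner b c = 0)"

definition is_onb :: "'a::complex_inner set \<Rightarrow> bool" where
  "is_onb B \<longleftrightarrow> orthonormal B \<and> closure (cspan B) = UNIV"

lemma cinner_orthonormal:
  assumes "orthonormal B" "b \<in> B" "c \<in> B"
  shows "cinner b c = (if b = c then 1 else 0)"
  using assms by (auto simp: orthonormal_def cinner_self)

lemma norm_sum_orthonormal: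
  assumes "orthonormal B" "finite F" "F \<subseteq> B"
  shows "(norm (\<Sum>b\<in>F. a b *\<^sub>C b))\<^sup>2 = (\<Sum>b\<in>F. (cmod (a b))\<^sup>2)"
proof -
  have "cinner (\<Sum>b\<in>F. a b *\<^sub>C b) (\<Sum>b\<in>F. a b *\<^sub>C b)
      = (\<Sum>b\<in>F. \<Sum>c\<in>F. a b * (cnj (a c) * (if b = c then 1 else 0)))"
    unfolding cinner_sum_left cinner_sum_right
    using assms by (intro sum.cong) (auto simp: cinner_orthonormal[of B] subset_iff)
  also have "\<dots> = (\<Sum>b\<in>F. complex_of_real ((cmod (a b))\<^sup>2))"
    unfolding complex_norm_square using assms(2) by (simp add: if_distrib cong: if_cong)
  finally show ?thesis
    unfolding cinner_self of_real_sum[symmetric] of_real_eq_iff .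
qed

lemma bessel:
  assumes "orthonormal B" "finite F" "F \<subseteq> B"
  shows "(\<Sum>b\<in>F. (cmod (cinner x b))\<^sup>2) \<le> (norm x)\<^sup>2"
proof -
  define p where "p = (\<Sum>b\<in>F. cinner x b *\<^sub>C b)"
  have p: "cinner x p = complex_of_real (\<Sum>b\<in>F. (cmod (cinner x b))\<^sup>2)"
    unfolding p_def cinner_sum_right of_real_sum complex_norm_square by (simp add: mult.commute)
  have "(norm p)\<^sup>2 = (\<Sum>b\<in>F. (cmod (cinner x b))\<^sup>2)"
    unfolding p_def by (rule norm_sum_orthonormal[OF assms])
  then have "(norm (x - p))\<^sup>2 = (norm x)\<^sup>2 - (\<Sum>b\<in>F. (cmod (cinner x b))\<^sup>2)"
    using p by (simp add: power2_norm_eq_inner inner_diff_left inner_diff_right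
        inner_commute[of p x]) (simp add: inner_eq_Re_cinner)
  then show ?thesis
    using zero_le_power2[of "norm (x - p)"] by linarith
qed

lemma summable_bessel:
  assumes "orthonormal B"
  shows "(\<lambda>b. (cmod (cinner x b))\<^sup>2) summable_on B"
proof (rule nonneg_bdd_above_summable_on)
  show "bdd_above (sum (\<lambda>b. (cmod (cinner x b))\<^sup>2) ` {F. F \<subseteq> B \<and> finite F})"
    by (rule bdd_aboveI2[where M = "(norm x)\<^sup>2"]) (simp add: bessel[OF assms])
qed simp

lemma summable_orthogonal:
  fixes f :: "'i \<Rightarrow> 'a::banach"
  assumes norm_sum: "\<And>F. finite F \<Longrightarrow> F \<subseteq> A \<Longrightarrow> (norm (sum f F))\<^sup>2 = (\<Sum>i\<in>F. (norm (f i))\<^sup>2)"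
    and summable: "(\<lambda>i. (norm (f i))\<^sup>2) summable_on A"
  shows "f summable_on A"
proof -
  let ?g = "\<lambda>i. (norm (f i))\<^sup>2"
  have "\<exists>P. eventually P (finite_subsets_at_top A) \<and>
      (\<forall>F F'. P F \<and> P F' \<longrightarrow> dist (sum f F) (sum f F') < e)" if "e > 0" for e
  proof -
    have "\<exists>F. finite F \<and> F \<subseteq> A \<and> dist (sum ?g F) (infsum ?g A) \<le> (e / 4)\<^sup>2"
      by (rule infsum_finite_approximation[OF summable]) (use \<open>e > 0\<close> in simp)
    then obtain F0 where F0: "finite F0" "F0 \<subseteq> A" "dist (sum ?g F0) (infsum ?g A) \<le> (e / 4)\<^sup>2"
      by blast
    have close: "dist (sum f F) (sum f F0) \<le> e / 4" if F: "finite F" "F \<subseteq> A" "F0 \<subseteq> F" for F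
    proof -
      have "(norm (sum f F - sum f F0))\<^sup>2 = (norm (sum f (F - F0)))\<^sup>2"
        using sum_diff[OF F(1,3), of f] by (simp only:)
      also have "\<dots> = sum ?g (F - F0)"
        by (rule norm_sum) (use F in blast)+
      also have "\<dots> = sum ?g F - sum ?g F0"
        by (rule sum_diff[OF F(1,3)])
      also have "\<dots> \<le> (e / 4)\<^sup>2"
        using F0(3) finite_sum_le_infsum[OF summable F(1,2)] by (simp add: dist_real_def)
      finally show ?thesis
        using \<open>e > 0\<close> by (simp add: dist_norm power2_le_iff_abs_le)
    qed
    have "eventually (\<lambda>F. finite F \<and> F \<subseteq> A \<and> F0 \<subseteq> F) (finite_subsets_at_top A)"
      unfolding eventually_finite_subsets_at_top using F0(1,2) by (intro exI[of _ F0]) simp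
    moreover have "dist (sum f F) (sum f F') < e"
      if "finite F \<and> F \<subseteq> A \<and> F0 \<subseteq> F" "finite F' \<and> F' \<subseteq> A \<and> F0 \<subseteq> F'" for F F'
    proof -
      have "dist (sum f F) (sum f F0) \<le> e / 4" "dist (sum f F') (sum f F0) \<le> e / 4"
        using close that by blast+
      then show ?thesis
        using \<open>e > 0\<close> dist_triangle2[of "sum f F" "sum f F'" "sum f F0"] by linarith
    qed
    ultimately show ?thesis
      by (intro exI[of _ "\<lambda>F. finite F \<and> F \<subseteq> A \<and> F0 \<subseteq> F"]) simp
  qed
  then have "cauchy_filter (filtermap (sum f) (finite_subsets_at_top A))"
    by (simp add: cauchy_filter_metric_filtermap)
  moreover have "complete (UNIV::'a set)"
    by (meson Cauchy_convergent UNIV_I complete_def convergent_def)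
  moreover have "filtermap (sum f) (finite_subsets_at_top A) \<noteq> bot"
    by (simp add: filtermap_bot_iff)
  ultimately have "\<exists>L. filtermap (sum f) (finite_subsets_at_top A) \<le> nhds L"
    unfolding complete_uniform by (metis UNIV_I principal_UNIV top_greatest)
  then show ?thesis
    unfolding summable_on_def has_sum_def filterlim_def .
qed

lemma has_sum_in_closure_cspan:
  assumes "(f has_sum s) A" "\<And>i. i \<in> A \<Longrightarrow> f i \<in> cspan S"
  shows "s \<in> closure (cspan S)"
proof (rule Lim_in_closed_set[OF closed_closure])
  show "(sum f \<longlongrightarrow> s) (finite_subsets_at_top A)"
    using assms(1) by (simp add: has_sum_def)
  show "\<forall>\<^sub>F F in finite_subsets_at_top A. sum f F \<in> closure (cspan S)"
  proof (rule eventually_finite_subsets_at_top_weakI)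
    fix F assume "F \<subseteq> A"
    then have "sum f F \<in> cspan S"
      by (intro complex_vector.span_sum assms(2)) auto
    then show "sum f F \<in> closure (cspan S)"
      using closure_subset by (rule rev_subsetD)
  qed
qed simp

lemma cinner_eq_0_closure_cspan:
  assumes "x \<in> closure (cspan B)" "\<And>b. b \<in> B \<Longrightarrow> cinner b z = 0"
  shows "cinner x z = 0"
proof -
  have "cinner y z = 0" if "y \<in> cspan B" for y
    using that by (induction rule: complex_vector.span_induct_alt)
      (simp_all add: assms(2) cinner_add_left)
  then have "cspan B \<subseteq> {y. cinner y z = 0}"
    by blast
  moreover have "closed {y. cinner y z = 0}"
    by (intro closed_Collect_eq continuous_on_const bounded_linear.continuous_on[OF
        bounded_bilinear.bounded_linear_left[OF bounded_bilinear_cinner]] continuous_on_id)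
  ultimately have "closure (cspan B) \<subseteq> {y. cinner y z = 0}"
    by (rule closure_minimal)
  with assms(1) show ?thesis
    by (simp add: subset_iff)
qed

lemma onb_expansion_exists:
  fixes x :: "'a::chilbert_space"
  assumes "orthonormal B"
  shows "\<exists>y. ((\<lambda>b. cinner x b *\<^sub>C b) has_sum y) B \<and> (\<forall>b\<in>B. cinner (x - y) b = 0)"
proof -
  have "(\<lambda>b. cinner x b *\<^sub>C b) summable_on B"
  proof (rule summable_orthogonal)
    have 1: "norm b = 1" if "b \<in> B" for b
      using assms that by (simp add: orthonormal_def)
    show "(norm (\<Sum>b\<in>F. cinner x b *\<^sub>C b))\<^sup>2 = (\<Sum>b\<in>F. (norm (cinner x b *\<^sub>C b))\<^sup>2)"
      if "finite F" "F \<subseteq> B" for F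
      unfolding norm_sum_orthonormal[OF assms that]
      by (rule sum.cong) (use that 1 in auto)
    show "(\<lambda>b. (norm (cinner x b *\<^sub>C b))\<^sup>2) summable_on B"
      using summable_bessel[OF assms, of x]
      by (rule summable_on_cong[THEN iffD1, rotated]) (simp add: 1)
  qed
  then obtain y where y: "((\<lambda>b. cinner x b *\<^sub>C b) has_sum y) B"
    by (auto simp: summable_on_def)
  have "cinner (x - y) c = 0" if "c \<in> B" for c
  proof -
    have "((\<lambda>b. cinner (cinner x b *\<^sub>C b) c) has_sum cinner y c) B"
      by (rule has_sum_bounded_linear[OF bounded_bilinear.bounded_linear_left[OF bounded_bilinear_cinner] y])
    moreover have "((\<lambda>b. cinner (cinner x b *\<^sub>C b) c) has_sum cinner x c) B"
      by (rule has_sum_finite_neutralI[where B = "{c}"])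
        (use that assms in \<open>auto simp: cinner_orthonormal[of B]\<close>)
    ultimately show ?thesis
      by (simp add: cinner_diff_left has_sum_unique)
  qed
  with y show ?thesis
    by blast
qed

lemma onb_expansion:
  fixes x :: "'a::chilbert_space"
  assumes "is_onb B"
  shows "((\<lambda>b. cinner x b *\<^sub>C b) has_sum x) B"
proof -
  obtain y where y: "((\<lambda>b. cinner x b *\<^sub>C b) has_sum y) B" "\<forall>b\<in>B. cinner (x - y) b = 0"
    using onb_expansion_exists assms unfolding is_onb_def by blast
  have "cinner (x - y) (x - y) = 0"
  proof (rule cinner_eq_0_closure_cspan[of _ B])
    show "x - y \<in> closure (cspan B)"
      using assms by (simp add: is_onb_def)
    show "cinner b (x - y) = 0" if "b \<in> B" for b
      using y(2) that cinner_commute[of b "x - y"] by simp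
  qed
  then have "x = y"
    by (simp add: cinner_self)
  with y(1) show ?thesis
    by simp
qed

lemma parseval:
  fixes x y :: "'a::chilbert_space"
  assumes "is_onb B"
  shows "((\<lambda>b. cinner x b * cinner b y) has_sum cinner x y) B"
  using has_sum_bounded_linear[OF bounded_bilinear.bounded_linear_left[OF bounded_bilinear_cinner]
      onb_expansion[OF assms, of x]] by simp

lemma onb_exists: "\<exists>B :: 'a::chilbert_space set. is_onb B"
proof -
  have "\<exists>M\<in>{B :: 'a set. orthonormal B}. \<forall>X\<in>{B. orthonormal B}. M \<subseteq> X \<longrightarrow> X = M"
  proof (rule subset_Zorn_nonempty)
    show "{B :: 'a set. orthonormal B} \<noteq> {}"
      by (auto simp: orthonormal_def intro!: exI[of _ "{}"])
    show "\<Union>\<C> \<in> {B :: 'a set. orthonormal B}"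
      if "\<C> \<noteq> {}" "subset.chain {B. orthonormal B} \<C>" for \<C>
    proof -
      have *: "orthonormal X" if "X \<in> \<C>" for X
        using that \<open>subset.chain {B. orthonormal B} \<C>\<close> by (auto simp: subset.chain_def)
      have "cinner b c = 0" if "b \<in> X" "X \<in> \<C>" "c \<in> Y" "Y \<in> \<C>" "b \<noteq> c" for b c X Y
      proof -
        have "X \<subseteq> Y \<or> Y \<subseteq> X"
          using that \<open>subset.chain {B. orthonormal B} \<C>\<close> by (auto simp: subset_chain_def)
        then show ?thesis
          using that *[of X] *[of Y] by (auto simp: orthonormal_def)
      qed
      then show ?thesis
        using * by (auto simp: orthonormal_def)
    qed
  qed
  then obtain B :: "'a set"
    where B: "orthonormal B" and max: "\<And>X. orthonormal X \<Longrightarrow> B \<subseteq> X \<Longrightarrow> X = B"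
    by blast
  have "x \<in> closure (cspan B)" for x
  proof -
    obtain y where y: "((\<lambda>b. cinner x b *\<^sub>C b) has_sum y) B" "\<forall>b\<in>B. cinner (x - y) b = 0"
      using onb_expansion_exists[OF B] by blast
    have "x = y"
    proof (rule ccontr)
      assume "x \<noteq> y"
      define u where "u = complex_of_real (1 / norm (x - y)) *\<^sub>C (x - y)"
      have u: "norm u = 1"
        using \<open>x \<noteq> y\<close> by (simp add: u_def norm_divide)
      have ub: "cinner u b = 0" if "b \<in> B" for b
        using y(2) that by (simp add: u_def)
      have bu: "cinner b u = 0" if "b \<in> B" for b
        using ub[OF that] cinner_commute[of b u] by simp
      have "orthonormal (insert u B)"
        using B u ub bu by (auto simp: orthonormal_def)
      then have "u \<in> B"
        using max[of "insert u B"] by blast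
      then have "cinner u u = 0"
        by (rule ub)
      then show False
        using u by (simp add: cinner_self)
    qed
    with has_sum_in_closure_cspan[OF y(1), of B] show ?thesis
      by (simp add: complex_vector.span_base complex_vector.span_scale)
  qed
  with B show ?thesis
    by (auto simp: is_onb_def)
qed

definition some_onb :: "'a::chilbert_space set" where
  "some_onb = (SOME B. is_onb B)"

lemma is_onb_some_onb: "is_onb (some_onb :: 'a::chilbert_space set)"
  unfolding some_onb_def by (rule someI_ex[OF onb_exists])

lemma orthonormal_some_onb: "orthonormal (some_onb :: 'a::chilbert_space set)"
  by (rule is_onb_some_onb[unfolded is_onb_def, THEN conjunct1])

section \<open>The Hilbert tensor product\<close>

text \<open>The Hilbert tensor product is realised as the direct sum of copies of the second factor
  indexed by a fixed orthonormal basis of the first.  What characterises it up to a canonical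
  unitary, independently of that basis, are the bilinearity of \<open>tensor_vec\<close> and the facts
  \<open>cinner_tensor_vec\<close> and \<open>closure_cspan_tensor_vec\<close> below.\<close>

typedef (overloaded) ('a::chilbert_space, 'b::chilbert_space) htensor =
  "{f :: ('a, 'b) ell2. \<forall>x. x \<notin> some_onb \<longrightarrow> Rep_ell2 f x = 0}"
  by (rule exI[of _ 0]) (simp add: zero_ell2.rep_eq)

setup_lifting type_definition_htensor

instantiation htensor :: (chilbert_space, chilbert_space) complex_inner
begin

lift_definition zero_htensor :: "('a, 'b) htensor" is 0
  by (simp add: zero_ell2.rep_eq)

lift_definition plus_htensor :: "('a, 'b) htensor \<Rightarrow> ('a, 'b) htensor \<Rightarrow> ('a, 'b) htensor" is
  "(+)"
  by (simp add: plus_ell2.rep_eq)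

lift_definition uminus_htensor :: "('a, 'b) htensor \<Rightarrow> ('a, 'b) htensor" is uminus
  by (simp add: uminus_ell2.rep_eq)

lift_definition minus_htensor :: "('a, 'b) htensor \<Rightarrow> ('a, 'b) htensor \<Rightarrow> ('a, 'b) htensor" is
  "(-)"
  by (simp add: minus_ell2.rep_eq)

lift_definition scaleC_htensor :: "complex \<Rightarrow> ('a, 'b) htensor \<Rightarrow> ('a, 'b) htensor" is
  scaleC
  by (simp add: scaleC_ell2.rep_eq)

lift_definition scaleR_htensor :: "real \<Rightarrow> ('a, 'b) htensor \<Rightarrow> ('a, 'b) htensor" is
  scaleR
  by (simp add: scaleR_ell2.rep_eq)

lift_definition cinner_htensor :: "('a, 'b) htensor \<Rightarrow> ('a, 'b) htensor \<Rightarrow> complex" is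
  cinner .

lift_definition inner_htensor :: "('a, 'b) htensor \<Rightarrow> ('a, 'b) htensor \<Rightarrow> real" is
  inner .

lift_definition norm_htensor :: "('a, 'b) htensor \<Rightarrow> real" is norm .

definition sgn_htensor :: "('a, 'b) htensor \<Rightarrow> ('a, 'b) htensor" where
  "sgn_htensor f = scaleR (inverse (norm f)) f"

definition dist_htensor :: "('a, 'b) htensor \<Rightarrow> ('a, 'b) htensor \<Rightarrow> real" where
  "dist_htensor f g = norm (f - g)"

definition uniformity_htensor :: "(('a, 'b) htensor \<times> ('a, 'b) htensor) filter" where
  "uniformity_htensor = (INF e\<in>{0<..}. principal {(f, g). dist f g < e})"

definition open_htensor :: "('a, 'b) htensor set \<Rightarrow> bool" where
  "open_htensor U = (\<forall>f\<in>U. eventually (\<lambda>(f', g). f' = f \<longrightarrow> g \<in> U) uniformity)"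

instance
proof
  fix f g h :: "('a, 'b) htensor" and r s :: real and c d :: complex
  show "f + g + h = f + (g + h)" by transfer (rule add.assoc)
  show "f + g = g + f" by transfer (rule add.commute)
  show "0 + f = f" by transfer simp
  show "- f + f = 0" by transfer simp
  show "f - g = f + - g" by transfer simp
  show "r *\<^sub>R (f + g) = r *\<^sub>R f + r *\<^sub>R g" by transfer (rule scaleR_add_right)
  show "(r + s) *\<^sub>R f = r *\<^sub>R f + s *\<^sub>R f" by transfer (rule scaleR_add_left)
  show "r *\<^sub>R s *\<^sub>R f = (r * s) *\<^sub>R f" by transfer simp
  show "1 *\<^sub>R f = f" by transfer simp
  show "r *\<^sub>R f = complex_of_real r *\<^sub>C f" by transfer (rule scaleR_scaleC)
  show "c *\<^sub>C (f + g) = c *\<^sub>C f + c *\<^sub>C g" by transfer (rule scaleC_add_right)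
  show "(c + d) *\<^sub>C f = c *\<^sub>C f + d *\<^sub>C f" by transfer (rule scaleC_add_left)
  show "c *\<^sub>C d *\<^sub>C f = (c * d) *\<^sub>C f" by transfer simp
  show "cinner f g = cnj (cinner g f)" by transfer (rule cinner_commute)
  show "cinner (f + g) h = cinner f h + cinner g h" by transfer (rule cinner_add_left)
  show "cinner (c *\<^sub>C f) g = c * cinner f g" by transfer simp
  show "f \<bullet> g = Re (cinner f g)" by transfer (rule inner_eq_Re_cinner)
  show "f \<bullet> g = g \<bullet> f" by transfer (rule inner_commute)
  show "(f + g) \<bullet> h = f \<bullet> h + g \<bullet> h" by transfer (rule inner_add_left)
  show "r *\<^sub>R f \<bullet> g = r * (f \<bullet> g)" by transfer simp
  show "0 \<le> f \<bullet> f" by transfer simp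
  show "f \<bullet> f = 0 \<longleftrightarrow> f = 0" by transfer simp
  show "norm f = sqrt (f \<bullet> f)" by transfer (rule norm_eq_sqrt_inner)
  show "sgn f = scaleR (inverse (norm f)) f" by (rule sgn_htensor_def)
  show "dist f g = norm (f - g)" by (rule dist_htensor_def)
  show "uniformity = (INF e\<in>{0<..}. principal {(f :: ('a, 'b) htensor, g). dist f g < e})"
    by (rule uniformity_htensor_def)
  show "open U = (\<forall>f\<in>U. eventually (\<lambda>(f', g). f' = f \<longrightarrow> g \<in> U) uniformity)"
    for U :: "('a, 'b) htensor set"
    by (rule open_htensor_def)
qed

end

lemma bounded_linear_Rep_htensor: "bounded_linear Rep_htensor"
  by (rule bounded_linear_intro[where K = 1])
    (simp_all add: plus_htensor.rep_eq scaleR_htensor.rep_eq norm_htensor.rep_eq)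

instance htensor :: (chilbert_space, chilbert_space) chilbert_space
proof
  fix X :: "nat \<Rightarrow> ('a, 'b) htensor"
  assume X: "Cauchy X"
  then have "Cauchy (\<lambda>n. Rep_htensor (X n))"
    by (rule bounded_linear.Cauchy[OF bounded_linear_Rep_htensor])
  then obtain l where l: "(\<lambda>n. Rep_htensor (X n)) \<longlonglongrightarrow> l"
    by (auto simp: Cauchy_convergent_iff convergent_def)
  have "Rep_ell2 l x = 0" if "x \<notin> some_onb" for x
  proof (rule LIMSEQ_unique)
    show "(\<lambda>n. Rep_ell2 (Rep_htensor (X n)) x) \<longlonglongrightarrow> Rep_ell2 l x"
      by (rule bounded_linear.tendsto[OF bounded_linear_Rep_ell2 l])
    have "Rep_ell2 (Rep_htensor (X n)) x = 0" for n
      using Rep_htensor[of "X n"] that by simp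
    then show "(\<lambda>n. Rep_ell2 (Rep_htensor (X n)) x) \<longlonglongrightarrow> 0"
      by simp
  qed
  then have L: "Rep_htensor (Abs_htensor l) = l"
    by (simp add: Abs_htensor_inverse)
  have "X \<longlonglongrightarrow> Abs_htensor l"
    using l unfolding tendsto_dist_iff[of X] tendsto_dist_iff[of "\<lambda>n. Rep_htensor (X n)"]
    by (simp add: dist_norm norm_htensor.rep_eq minus_htensor.rep_eq L)
  then show "convergent X"
    by (rule convergentI)
qed

lift_definition tensor_ell2 :: "'a::chilbert_space \<Rightarrow> 'b::chilbert_space \<Rightarrow> ('a, 'b) ell2" is
  "\<lambda>x y b. if b \<in> some_onb then cinner x b *\<^sub>C y else 0"
proof -
  fix x :: 'a and y :: 'b
  have "(\<lambda>b. (cmod (cinner x b))\<^sup>2 * (norm y)\<^sup>2) summable_on some_onb"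
    by (intro summable_on_cmult_left summable_bessel orthonormal_some_onb)
  then show "(\<lambda>b. (norm (if b \<in> some_onb then cinner x b *\<^sub>C y else 0))\<^sup>2) summable_on UNIV"
    by (rule summable_on_cong_neutral[THEN iffD1, rotated -1])
      (simp_all add: power_mult_distrib)
qed

lift_definition tensor_vec :: "'a::chilbert_space \<Rightarrow> 'b::chilbert_space \<Rightarrow> ('a, 'b) htensor"
  (infixr "\<otimes>\<^sub>v" 76) is tensor_ell2
  by (simp add: tensor_ell2.rep_eq)

lemma tensor_vec_add_left: "(x + x') \<otimes>\<^sub>v y = x \<otimes>\<^sub>v y + x' \<otimes>\<^sub>v y"
  by (transfer, transfer) (auto simp: cinner_add_left scaleC_add_left)

lemma tensor_vec_add_right: "x \<otimes>\<^sub>v (y + y') = x \<otimes>\<^sub>v y + x \<otimes>\<^sub>v y'"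
  by (transfer, transfer) (auto simp: scaleC_add_right)

lemma tensor_vec_scaleC_left: "(c *\<^sub>C x) \<otimes>\<^sub>v y = c *\<^sub>C (x \<otimes>\<^sub>v y)"
  by (transfer, transfer) auto

lemma tensor_vec_scaleC_right: "x \<otimes>\<^sub>v (c *\<^sub>C y) = c *\<^sub>C (x \<otimes>\<^sub>v y)"
  by (transfer, transfer) (auto simp: mult.commute)

lemma cinner_tensor_vec: "cinner (x \<otimes>\<^sub>v y) (x' \<otimes>\<^sub>v y') = cinner x x' * cinner y y'"
proof -
  have "((\<lambda>b. cinner x b * cinner b x' * cinner y y') has_sum cinner x x' * cinner y y') some_onb"
    by (intro has_sum_cmult_left parseval is_onb_some_onb)
  then have "((\<lambda>b. cinner (Rep_ell2 (tensor_ell2 x y) b) (Rep_ell2 (tensor_ell2 x' y') b))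
      has_sum cinner x x' * cinner y y') UNIV"
    by (rule has_sum_cong_neutral[THEN iffD1, rotated -1])
      (auto simp: tensor_ell2.rep_eq cinner_commute[of x'])
  then show ?thesis
    unfolding cinner_htensor.rep_eq tensor_vec.rep_eq
    using cinner_ell2_has_sum has_sum_unique by blast
qed

lemma norm_tensor_vec: "norm (x \<otimes>\<^sub>v y) = norm x * norm y"
proof -
  have "complex_of_real ((norm (x \<otimes>\<^sub>v y))\<^sup>2) = complex_of_real ((norm x * norm y)\<^sup>2)"
    using cinner_tensor_vec[of x y x y]
    by (simp only: cinner_self power_mult_distrib of_real_mult)
  then show ?thesis
    by (simp only: of_real_eq_iff) (simp add: power2_eq_iff_nonneg)
qed

lemma closure_cspan_tensor_vec:
  "closure (cspan {x \<otimes>\<^sub>v y | x y. True}) = (UNIV :: ('a::chilbert_space, 'b::chilbert_space) htensor set)"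
proof (rule UNIV_eq_I[symmetric])
  fix f :: "('a, 'b) htensor"
  define c where "c = Rep_ell2 (Rep_htensor f)"
  define t where "t b = b \<otimes>\<^sub>v c b" for b
  have onb: "orthonormal (some_onb :: 'a set)"
    by (rule orthonormal_some_onb)
  have c0: "c b = 0" if "b \<notin> some_onb" for b
    using Rep_htensor[of f] that by (simp add: c_def)
  have norm_t: "norm (t b) = norm (c b)" if "b \<in> some_onb" for b
    using onb that by (simp add: t_def norm_tensor_vec orthonormal_def)
  have "t summable_on some_onb"
  proof (rule summable_orthogonal)
    show "(norm (sum t F))\<^sup>2 = (\<Sum>b\<in>F. (norm (t b))\<^sup>2)" if F: "finite F" "F \<subseteq> some_onb" for F
    proof -
      have "cinner (sum t F) (sum t F) = (\<Sum>b\<in>F. \<Sum>d\<in>F. if b = d then cinner (t b) (t b) else 0)"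
        unfolding cinner_sum_left cinner_sum_right
        using F by (intro sum.cong refl)
          (auto simp: t_def cinner_tensor_vec cinner_orthonormal[OF onb] subset_iff)
      also have "\<dots> = (\<Sum>b\<in>F. complex_of_real ((norm (t b))\<^sup>2))"
        using F(1) by (simp add: cinner_self)
      finally show ?thesis
        unfolding cinner_self of_real_sum[symmetric] of_real_eq_iff .
    qed
    have "(\<lambda>b. (norm (c b))\<^sup>2) summable_on some_onb"
      by (rule summable_on_subset_banach[of _ UNIV])
        (use norm_ell2_has_sum[of "Rep_htensor f"] in \<open>auto simp: c_def summable_on_def\<close>)
    then show "(\<lambda>b. (norm (t b))\<^sup>2) summable_on some_onb"
      by (rule summable_on_cong[THEN iffD1, rotated]) (simp add: norm_t)
  qed
  then obtain g where g: "(t has_sum g) some_onb"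
    by (auto simp: summable_on_def)
  have "Rep_ell2 (Rep_htensor g) i = c i" for i
  proof (rule has_sum_unique)
    show "((\<lambda>b. Rep_ell2 (Rep_htensor (t b)) i) has_sum Rep_ell2 (Rep_htensor g) i) some_onb"
      by (intro has_sum_bounded_linear[OF bounded_linear_Rep_ell2]
          has_sum_bounded_linear[OF bounded_linear_Rep_htensor] g)
    have R: "Rep_ell2 (Rep_htensor (t b)) i = (if b = i then c i else 0)" if "b \<in> some_onb" for b
      using that c0
      by (auto simp: t_def tensor_vec.rep_eq tensor_ell2.rep_eq cinner_orthonormal[OF onb])
    show "((\<lambda>b. Rep_ell2 (Rep_htensor (t b)) i) has_sum c i) some_onb"
    proof (cases "i \<in> some_onb")
      case True
      then show ?thesis
        by (intro has_sum_finite_neutralI[where B = "{i}"]) (auto simp: R)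
    next
      case False
      then have "((\<lambda>b. Rep_ell2 (Rep_htensor (t b)) i) has_sum 0) some_onb"
        by (intro has_sum_0) (auto simp: R)
      then show ?thesis
        using c0[OF False] by simp
    qed
  qed
  then have "Rep_ell2 (Rep_htensor g) = Rep_ell2 (Rep_htensor f)"
    by (auto simp: c_def)
  then have "g = f"
    by (simp add: Rep_ell2_inject Rep_htensor_inject)
  with has_sum_in_closure_cspan[OF g, of "{x \<otimes>\<^sub>v y | x y. True}"]
  show "f \<in> closure (cspan {x \<otimes>\<^sub>v y | x y. True})"
    by (auto simp: t_def intro: complex_vector.span_base)
qed

section \<open>Bounded operators\<close>

typedef (overloaded) ('a, 'b) cblinfun =
  "{f :: 'a::complex_inner \<Rightarrow> 'b::complex_inner.
      bounded_linear f \<and> (\<forall>c x. f (c *\<^sub>C x) = c *\<^sub>C f x)}"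
  morphisms cblinfun_apply Abs_cblinfun
  by (rule exI[of _ "\<lambda>_. 0"]) (simp add: bounded_linear_zero)

type_synonym 'a operator = "('a, 'a) cblinfun"

notation cblinfun_apply (infixr "*\<^sub>V" 70)

setup_lifting type_definition_cblinfun

lemma bounded_linear_cblinfun_apply: "bounded_linear (cblinfun_apply X)"
  using cblinfun_apply by blast

lemma cblinfun_apply_scaleC [simp]: "X *\<^sub>V c *\<^sub>C x = c *\<^sub>C (X *\<^sub>V x)"
  using cblinfun_apply by blast

lemma cblinfun_apply_add: "X *\<^sub>V (x + y) = (X *\<^sub>V x) + (X *\<^sub>V y)"
  by (rule linear_add[OF bounded_linear.linear[OF bounded_linear_cblinfun_apply]])

lemma cblinfun_eqI: "(\<And>x. X *\<^sub>V x = Y *\<^sub>V x) \<Longrightarrow> X = Y"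
  by (simp add: cblinfun_apply_inject[symmetric] ext)

instantiation cblinfun :: (complex_inner, complex_inner) real_normed_vector
begin

lift_definition zero_cblinfun :: "('a, 'b) cblinfun" is "\<lambda>_. 0"
  by (simp add: bounded_linear_zero)

lift_definition plus_cblinfun :: "('a, 'b) cblinfun \<Rightarrow> ('a, 'b) cblinfun \<Rightarrow> ('a, 'b) cblinfun" is
  "\<lambda>f g x. f x + g x"
  by (simp add: bounded_linear_add scaleC_add_right)

lift_definition uminus_cblinfun :: "('a, 'b) cblinfun \<Rightarrow> ('a, 'b) cblinfun" is
  "\<lambda>f x. - f x"
  by (simp add: bounded_linear_minus)

lift_definition minus_cblinfun :: "('a, 'b) cblinfun \<Rightarrow> ('a, 'b) cblinfun \<Rightarrow> ('a, 'b) cblinfun" is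
  "\<lambda>f g x. f x - g x"
  by (simp add: bounded_linear_sub scaleC_diff_right)

lift_definition scaleR_cblinfun :: "real \<Rightarrow> ('a, 'b) cblinfun \<Rightarrow> ('a, 'b) cblinfun" is
  "\<lambda>r f x. r *\<^sub>R f x"
  by (simp add: bounded_linear_const_scaleR) (simp add: scaleR_scaleC mult.commute)

lift_definition norm_cblinfun :: "('a, 'b) cblinfun \<Rightarrow> real" is onorm .

definition sgn_cblinfun :: "('a, 'b) cblinfun \<Rightarrow> ('a, 'b) cblinfun" where
  "sgn_cblinfun X = scaleR (inverse (norm X)) X"

definition dist_cblinfun :: "('a, 'b) cblinfun \<Rightarrow> ('a, 'b) cblinfun \<Rightarrow> real" where
  "dist_cblinfun X Y = norm (X - Y)"

definition uniformity_cblinfun :: "(('a, 'b) cblinfun \<times> ('a, 'b) cblinfun) filter" where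
  "uniformity_cblinfun = (INF e\<in>{0<..}. principal {(X, Y). dist X Y < e})"

definition open_cblinfun :: "('a, 'b) cblinfun set \<Rightarrow> bool" where
  "open_cblinfun U = (\<forall>X\<in>U. eventually (\<lambda>(X', Y). X' = X \<longrightarrow> Y \<in> U) uniformity)"

instance
proof
  fix X Y Z :: "('a, 'b) cblinfun" and r s :: real
  show "X + Y + Z = X + (Y + Z)" by transfer (simp add: add.assoc)
  show "X + Y = Y + X" by transfer (simp add: add.commute)
  show "0 + X = X" by transfer simp
  show "- X + X = 0" by transfer simp
  show "X - Y = X + - Y" by transfer simp
  show "r *\<^sub>R (X + Y) = r *\<^sub>R X + r *\<^sub>R Y" by transfer (simp add: scaleR_add_right)
  show "(r + s) *\<^sub>R X = r *\<^sub>R X + s *\<^sub>R X" by transfer (simp add: scaleR_add_left)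
  show "r *\<^sub>R s *\<^sub>R X = (r * s) *\<^sub>R X" by transfer simp
  show "1 *\<^sub>R X = X" by transfer simp
  show "sgn X = scaleR (inverse (norm X)) X" by (rule sgn_cblinfun_def)
  show "dist X Y = norm (X - Y)" by (rule dist_cblinfun_def)
  show "uniformity = (INF e\<in>{0<..}. principal {(X :: ('a, 'b) cblinfun, Y). dist X Y < e})"
    by (rule uniformity_cblinfun_def)
  show "open U = (\<forall>X\<in>U. eventually (\<lambda>(X', Y). X' = X \<longrightarrow> Y \<in> U) uniformity)"
    for U :: "('a, 'b) cblinfun set"
    by (rule open_cblinfun_def)
  show "norm X = 0 \<longleftrightarrow> X = 0"
    by transfer (auto simp: onorm_eq_0)
  show "norm (X + Y) \<le> norm X + norm Y"
    by transfer (auto intro: onorm_triangle)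
  show "norm (r *\<^sub>R X) = \<bar>r\<bar> * norm X"
    by transfer (auto intro: onorm_scaleR)
qed

end

instantiation cblinfun :: (complex_inner, complex_inner) scaleC
begin

lift_definition scaleC_cblinfun :: "complex \<Rightarrow> ('a, 'b) cblinfun \<Rightarrow> ('a, 'b) cblinfun" is
  "\<lambda>c f x. c *\<^sub>C f x"
  by (auto intro: bounded_linear_compose[OF bounded_linear_scaleC] simp: mult.commute)

instance ..

end

interpretation cblinfun_vector:
  vector_space "scaleC :: complex \<Rightarrow> ('a, 'b) cblinfun \<Rightarrow> ('a::complex_inner, 'b::complex_inner) cblinfun"
  by standard
    (transfer, simp add: scaleC_add_left scaleC_add_right)+

lemma norm_cblinfun_apply_le: "norm (X *\<^sub>V x) \<le> norm X * norm x"
  by transfer (auto intro: onorm)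

lemma cmod_cinner_cblinfun_le: "cmod (cinner (X *\<^sub>V x) y) \<le> norm X * norm x * norm y"
  by (rule order_trans[OF cmod_cinner_le mult_right_mono[OF norm_cblinfun_apply_le norm_ge_zero]])

lemma norm_cblinfun_bound:
  "0 \<le> K \<Longrightarrow> (\<And>x. norm (X *\<^sub>V x) \<le> K * norm x) \<Longrightarrow> norm X \<le> K"
  by transfer (auto intro: onorm_bound)

lift_definition id_op :: "'a::complex_inner operator" is "\<lambda>x. x"
  by (simp add: bounded_linear_ident)

lift_definition comp_op ::
  "('b::complex_inner, 'c::complex_inner) cblinfun \<Rightarrow> ('a::complex_inner, 'b) cblinfun \<Rightarrow> ('a, 'c) cblinfun"
  (infixl "\<bullet>\<^sub>o" 75) is "\<lambda>f g x. f (g x)"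
  by (auto intro: bounded_linear_compose)

definition adj :: "('a::chilbert_space, 'b::chilbert_space) cblinfun \<Rightarrow> ('b, 'a) cblinfun" where
  "adj X = (THE Y. \<forall>x y. cinner (X *\<^sub>V x) y = cinner x (Y *\<^sub>V y))"

definition positive_op :: "'a::complex_inner operator \<Rightarrow> bool" where
  "positive_op X \<longleftrightarrow> (\<forall>x. cinner (X *\<^sub>V x) x \<in> \<real> \<and> 0 \<le> Re (cinner (X *\<^sub>V x) x))"

definition op_le :: "'a::complex_inner operator \<Rightarrow> 'a operator \<Rightarrow> bool" (infix "\<le>\<^sub>o" 50) where
  "X \<le>\<^sub>o Y \<longleftrightarrow> positive_op (Y - X)"

definition Re_op :: "'a::chilbert_space operator \<Rightarrow> 'a operator" where
  "Re_op X = (1 / 2) *\<^sub>C (X + adj X)"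

definition tensor_op :: "'a::chilbert_space operator \<Rightarrow> 'b::chilbert_space operator
    \<Rightarrow> ('a, 'b) htensor operator" (infixr "\<otimes>\<^sub>o" 76) where
  "X \<otimes>\<^sub>o Y = (THE Z. \<forall>x y. Z *\<^sub>V x \<otimes>\<^sub>v y = (X *\<^sub>V x) \<otimes>\<^sub>v (Y *\<^sub>V y))"

text \<open>The two definite descriptions above denote: adjoints exist by completeness, and
  \<^term>\<open>X \<otimes>\<^sub>o Y\<close> exists because elementary tensors are total.\<close>

lemma adj_exists:
  fixes X :: "('a::chilbert_space, 'b::chilbert_space) cblinfun"
  shows "\<exists>Y. \<forall>x y. cinner (X *\<^sub>V x) y = cinner x (Y *\<^sub>V y)"
proof -
  let ?B = "some_onb :: 'a set"
  note onb = orthonormal_some_onb[where 'a = 'a]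
  have "\<exists>z. \<forall>x. cinner (X *\<^sub>V x) y = cinner x z" for y
  proof -
    define a where "a b = cnj (cinner (X *\<^sub>V b) y)" for b
    have partial: "(norm (\<Sum>b\<in>F. a b *\<^sub>C b))\<^sup>2 = (\<Sum>b\<in>F. (cmod (a b))\<^sup>2)"
      "(\<Sum>b\<in>F. (cmod (a b))\<^sup>2) \<le> (norm X * norm y)\<^sup>2" if F: "finite F" "F \<subseteq> ?B" for F
    proof -
      let ?s = "\<Sum>b\<in>F. a b *\<^sub>C b"
      show n: "(norm ?s)\<^sup>2 = (\<Sum>b\<in>F. (cmod (a b))\<^sup>2)"
        by (rule norm_sum_orthonormal[OF onb F])
      have "X *\<^sub>V ?s = (\<Sum>b\<in>F. a b *\<^sub>C (X *\<^sub>V b))"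
        by (simp add: linear_sum[OF bounded_linear.linear[OF bounded_linear_cblinfun_apply]])
      then have "cinner (X *\<^sub>V ?s) y = (\<Sum>b\<in>F. complex_of_real ((cmod (a b))\<^sup>2))"
        unfolding complex_norm_square by (simp add: cinner_sum_left a_def)
      then have "(norm ?s)\<^sup>2 = cmod (cinner (X *\<^sub>V ?s) y)"
        unfolding of_real_sum[symmetric] n[symmetric] by (simp del: of_real_power)
      also have "\<dots> \<le> norm X * norm ?s * norm y"
        by (rule cmod_cinner_cblinfun_le)
      finally have "norm ?s * norm ?s \<le> norm ?s * (norm X * norm y)"
        by (simp add: power2_eq_square mult_ac)
      then have "norm ?s \<le> norm X * norm y"
        by (cases "norm ?s = 0") (auto simp: mult_le_cancel_left)
      then show "(\<Sum>b\<in>F. (cmod (a b))\<^sup>2) \<le> (norm X * norm y)\<^sup>2"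
        unfolding n[symmetric] by (rule power_mono) simp
    qed
    have "(\<lambda>b. a b *\<^sub>C b) summable_on ?B"
    proof (rule summable_orthogonal)
      have 1: "norm b = 1" if "b \<in> ?B" for b
        using onb that by (simp add: orthonormal_def)
      show "(norm (\<Sum>b\<in>F. a b *\<^sub>C b))\<^sup>2 = (\<Sum>b\<in>F. (norm (a b *\<^sub>C b))\<^sup>2)"
        if "finite F" "F \<subseteq> ?B" for F
        unfolding partial(1)[OF that] by (rule sum.cong) (use that 1 in auto)
      have "(\<lambda>b. (cmod (a b))\<^sup>2) summable_on ?B"
      proof (rule nonneg_bdd_above_summable_on)
        show "bdd_above (sum (\<lambda>b. (cmod (a b))\<^sup>2) ` {F. F \<subseteq> ?B \<and> finite F})"
          by (rule bdd_aboveI2[where M = "(norm X * norm y)\<^sup>2"]) (simp add: partial(2))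
      qed simp
      then show "(\<lambda>b. (norm (a b *\<^sub>C b))\<^sup>2) summable_on ?B"
        by (rule summable_on_cong[THEN iffD1, rotated]) (simp add: 1)
    qed
    then obtain z where z: "((\<lambda>b. a b *\<^sub>C b) has_sum z) ?B"
      by (auto simp: summable_on_def)
    have "cinner (X *\<^sub>V x) y = cinner x z" for x
    proof (rule has_sum_unique)
      have "((\<lambda>b. cinner (X *\<^sub>V cinner x b *\<^sub>C b) y) has_sum cinner (X *\<^sub>V x) y) ?B"
        by (intro has_sum_bounded_linear[OF bounded_bilinear.bounded_linear_left[OF bounded_bilinear_cinner]]
            has_sum_bounded_linear[OF bounded_linear_cblinfun_apply] onb_expansion is_onb_some_onb)
      then show "((\<lambda>b. cinner x b * cinner (X *\<^sub>V b) y) has_sum cinner (X *\<^sub>V x) y) ?B"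
        by simp
      have "((\<lambda>b. cinner x (a b *\<^sub>C b)) has_sum cinner x z) ?B"
        by (rule has_sum_bounded_linear[OF bounded_bilinear.bounded_linear_right[OF bounded_bilinear_cinner] z])
      then show "((\<lambda>b. cinner x b * cinner (X *\<^sub>V b) y) has_sum cinner x z) ?B"
        by (simp add: a_def mult.commute)
    qed
    then show ?thesis
      by blast
  qed
  then obtain g where g: "\<And>x y. cinner (X *\<^sub>V x) y = cinner x (g y)"
    by metis
  have "norm (g y) \<le> norm X * norm y" for y
  proof -
    have "(norm (g y))\<^sup>2 = cmod (cinner (X *\<^sub>V g y) y)"
      by (simp add: g cinner_self del: of_real_power)
    also have "\<dots> \<le> norm X * norm (g y) * norm y"
      by (rule cmod_cinner_cblinfun_le)
    finally have "norm (g y) * norm (g y) \<le> norm (g y) * (norm X * norm y)"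
      by (simp add: power2_eq_square mult_ac)
    then show ?thesis
      by (cases "norm (g y) = 0") (auto simp: mult_le_cancel_left)
  qed
  moreover have scale: "g (c *\<^sub>C y) = c *\<^sub>C g y" for c y
    by (rule cinner_ext_right) (simp flip: g)
  moreover have "g (y + z) = g y + g z" for y z
    by (rule cinner_ext_right) (simp add: cinner_add_right flip: g)
  ultimately have "g \<in> {f. bounded_linear f \<and> (\<forall>c x. f (c *\<^sub>C x) = c *\<^sub>C f x)}"
    by (auto intro!: bounded_linear_intro[where K = "norm X"] simp: scaleR_scaleC mult.commute)
  then show ?thesis
    using g by (intro exI[of _ "Abs_cblinfun g"]) (simp add: Abs_cblinfun_inverse)
qed

lemma cinner_adj: "cinner (X *\<^sub>V x) y = cinner x (adj X *\<^sub>V y)"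
proof -
  define P where "P Y \<longleftrightarrow> (\<forall>x y. cinner (X *\<^sub>V x) y = cinner x (Y *\<^sub>V y))" for Y
  have "\<exists>Y. P Y"
    unfolding P_def by (rule adj_exists)
  moreover have "Y = Z" if "P Y" "P Z" for Y Z
  proof (rule cblinfun_eqI, rule cinner_ext_right)
    fix x y
    show "cinner x (Y *\<^sub>V y) = cinner x (Z *\<^sub>V y)"
      using that unfolding P_def by simp
  qed
  ultimately have "\<exists>!Y. P Y"
    by (rule ex_ex1I)
  then have P: "P (adj X)"
    unfolding adj_def P_def[symmetric] by (rule theI')
  show ?thesis
    by (rule P[unfolded P_def, rule_format])
qed

lemma cspan_range_sum:
  assumes "x \<in> cspan (range v)"
  shows "\<exists>F c. finite F \<and> x = (\<Sum>i\<in>F. c i *\<^sub>C v i)"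
proof -
  obtain t r where t: "finite t" "t \<subseteq> range v" "x = (\<Sum>a\<in>t. r a *\<^sub>C a)"
    using assms unfolding complex_vector.span_explicit by blast
  obtain F where F: "t = v ` F" "inj_on v F"
    using t(2) by (metis subset_image_inj)
  have "x = (\<Sum>i\<in>F. r (v i) *\<^sub>C v i)"
    unfolding t(3) F(1) by (simp add: sum.reindex[OF F(2)])
  moreover have "finite F"
    using t(1) unfolding F(1) by (rule finite_imageD[OF _ F(2)])
  ultimately show ?thesis
    by (intro exI[of _ F] exI[of _ "\<lambda>i. r (v i)"] conjI)
qed

lemma cblinfun_extension:
  fixes v :: "'i \<Rightarrow> 'a::complex_inner" and w :: "'i \<Rightarrow> 'b::chilbert_space"
  assumes dense: "closure (cspan (range v)) = UNIV"
    and bound: "\<And>F c. finite F \<Longrightarrow>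
      norm (\<Sum>i\<in>F. c i *\<^sub>C w i) \<le> K * norm (\<Sum>i\<in>F. c i *\<^sub>C v i)"
    and "0 \<le> K"
  shows "\<exists>Z. \<forall>i. Z *\<^sub>V v i = w i"
proof -
  define G where "G = {(\<Sum>i\<in>F. c i *\<^sub>C v i, \<Sum>i\<in>F. c i *\<^sub>C w i) | F c. finite F}"
  have G_le: "norm b \<le> K * norm a" if ab: "(a, b) \<in> G" for a b
  proof -
    obtain F c where "finite F" "a = (\<Sum>i\<in>F. c i *\<^sub>C v i)" "b = (\<Sum>i\<in>F. c i *\<^sub>C w i)"
      using ab by (auto simp: G_def)
    then show ?thesis
      using bound[of F c] by simp
  qed
  have G_add: "(a + a', b + b') \<in> G" if ab: "(a, b) \<in> G" "(a', b') \<in> G" for a a' b b'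
  proof -
    obtain F c F' c' where *: "finite F" "finite F'"
      "a = (\<Sum>i\<in>F. c i *\<^sub>C v i)" "b = (\<Sum>i\<in>F. c i *\<^sub>C w i)"
      "a' = (\<Sum>i\<in>F'. c' i *\<^sub>C v i)" "b' = (\<Sum>i\<in>F'. c' i *\<^sub>C w i)"
      using ab by (auto simp: G_def)
    define d where "d i = (if i \<in> F then c i else 0) + (if i \<in> F' then c' i else 0)" for i
    have "(\<Sum>i\<in>F. c i *\<^sub>C u i) + (\<Sum>i\<in>F'. c' i *\<^sub>C u i) = (\<Sum>i\<in>F \<union> F'. d i *\<^sub>C u i)"
      for u :: "'i \<Rightarrow> 'c::complex_inner"
    proof -
      have "(\<Sum>i\<in>F. c i *\<^sub>C u i) = (\<Sum>i\<in>F \<union> F'. (if i \<in> F then c i else 0) *\<^sub>C u i)"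
        using *(1,2) by (intro sum.mono_neutral_cong_left) auto
      moreover have "(\<Sum>i\<in>F'. c' i *\<^sub>C u i) = (\<Sum>i\<in>F \<union> F'. (if i \<in> F' then c' i else 0) *\<^sub>C u i)"
        using *(1,2) by (intro sum.mono_neutral_cong_left) auto
      ultimately show ?thesis
        by (simp add: d_def scaleC_add_left sum.distrib)
    qed
    from this[of v] this[of w] show ?thesis
      unfolding G_def mem_Collect_eq *(3-6) using *(1,2)
      by (intro exI[of _ "F \<union> F'"] exI[of _ d]) simp
  qed
  have G_scale: "(k *\<^sub>C a, k *\<^sub>C b) \<in> G" if ab: "(a, b) \<in> G" for a b k
  proof -
    obtain F c where *: "finite F" "a = (\<Sum>i\<in>F. c i *\<^sub>C v i)" "b = (\<Sum>i\<in>F. c i *\<^sub>C w i)"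
      using ab by (auto simp: G_def)
    have "k *\<^sub>C a = (\<Sum>i\<in>F. (k * c i) *\<^sub>C v i)" "k *\<^sub>C b = (\<Sum>i\<in>F. (k * c i) *\<^sub>C w i)"
      unfolding * by (simp_all add: complex_vector.scale_sum_right)
    with *(1) show ?thesis
      unfolding G_def mem_Collect_eq by (intro exI[of _ F] exI[of _ "\<lambda>i. k * c i"]) simp
  qed
  define R where "R a b \<longleftrightarrow>
    (\<exists>x y. (\<forall>n. (x n, y n) \<in> G) \<and> x \<longlonglongrightarrow> a \<and> y \<longlonglongrightarrow> b)" for a b
  have R_le: "norm b \<le> K * norm a" if ab: "R a b" for a b
  proof -
    obtain x y where *: "\<And>n. (x n, y n) \<in> G" "x \<longlonglongrightarrow> a" "y \<longlonglongrightarrow> b"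
      using ab unfolding R_def by blast
    show ?thesis
      by (rule LIMSEQ_le[OF tendsto_norm[OF *(3)] tendsto_mult_left[OF tendsto_norm[OF *(2)]]])
        (use G_le *(1) in blast)
  qed
  have R_add: "R (a + a') (b + b')" if ab: "R a b" "R a' b'" for a a' b b'
  proof -
    obtain x y where 1: "\<And>n. (x n, y n) \<in> G" "x \<longlonglongrightarrow> a" "y \<longlonglongrightarrow> b"
      using ab(1) unfolding R_def by blast
    obtain x' y' where 2: "\<And>n. (x' n, y' n) \<in> G" "x' \<longlonglongrightarrow> a'" "y' \<longlonglongrightarrow> b'"
      using ab(2) unfolding R_def by blast
    show ?thesis
      unfolding R_def
      by (intro exI[of _ "\<lambda>n. x n + x' n"] exI[of _ "\<lambda>n. y n + y' n"] conjI allI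
          G_add 1 2 tendsto_add)
  qed
  have R_scale: "R (k *\<^sub>C a) (k *\<^sub>C b)" if ab: "R a b" for a b k
  proof -
    obtain x y where 1: "\<And>n. (x n, y n) \<in> G" "x \<longlonglongrightarrow> a" "y \<longlonglongrightarrow> b"
      using ab unfolding R_def by blast
    show ?thesis
      unfolding R_def
      by (intro exI[of _ "\<lambda>n. k *\<^sub>C x n"] exI[of _ "\<lambda>n. k *\<^sub>C y n"] conjI allI
          G_scale 1 bounded_linear.tendsto[OF bounded_linear_scaleC])
  qed
  have R_unique: "b = b'" if "R a b" "R a b'" for a b b'
    using R_le[OF R_add[OF that(1) R_scale[OF that(2), of "-1"]]] by simp
  have "\<exists>b. R a b" for a
  proof -
    obtain x where x: "\<And>n. x n \<in> cspan (range v)" "x \<longlonglongrightarrow> a"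
      using closure_sequential[of a "cspan (range v)"] unfolding dense by blast
    have "\<exists>b. (x n, b) \<in> G" for n
    proof -
      obtain F c where "finite F" "x n = (\<Sum>i\<in>F. c i *\<^sub>C v i)"
        using cspan_range_sum[OF x(1)[of n]] by blast
      then show ?thesis
        unfolding G_def mem_Collect_eq
        by (intro exI[of _ "\<Sum>i\<in>F. c i *\<^sub>C w i"] exI[of _ F] exI[of _ c]) simp
    qed
    then obtain y where y: "\<And>n. (x n, y n) \<in> G"
      by metis
    have le: "norm (y m - y n) \<le> K * norm (x m - x n)" for m n
      using G_le[OF G_add[OF y[of m] G_scale[OF y[of n], of "-1"]]] by simp
    have "Cauchy y"
    proof (rule CauchyI)
      fix e :: real assume "e > 0"
      have "Cauchy x"
        using x(2) by (rule LIMSEQ_imp_Cauchy)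
      then obtain M where M: "\<And>m n. m \<ge> M \<Longrightarrow> n \<ge> M \<Longrightarrow> norm (x m - x n) < e / (K + 1)"
        using \<open>e > 0\<close> \<open>0 \<le> K\<close> CauchyD[of x "e / (K + 1)"] by auto
      have "norm (y m - y n) < e" if "m \<ge> M" "n \<ge> M" for m n
      proof -
        have "norm (y m - y n) \<le> (K + 1) * norm (x m - x n)"
          using le[of m n] by (simp add: distrib_right add_increasing2)
        also have "\<dots> < e"
          using M[OF that] \<open>0 \<le> K\<close> by (simp add: field_simps)
        finally show ?thesis .
      qed
      then show "\<exists>M. \<forall>m\<ge>M. \<forall>n\<ge>M. norm (y m - y n) < e"
        by blast
    qed
    then obtain b where "y \<longlonglongrightarrow> b"
      by (auto simp: Cauchy_convergent_iff convergent_def)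
    with x(2) y show ?thesis
      unfolding R_def by (intro exI[of _ b] exI[of _ x] exI[of _ y]) simp
  qed
  then obtain g where g: "\<And>a. R a (g a)"
    by metis
  have "g (a + b) = g a + g b" for a b
    by (rule R_unique[OF g R_add[OF g g]])
  moreover have scale: "g (c *\<^sub>C a) = c *\<^sub>C g a" for c a
    by (rule R_unique[OF g R_scale[OF g]])
  moreover have "norm (g a) \<le> norm a * K" for a
    using R_le[OF g] by (simp add: mult.commute)
  ultimately have "g \<in> {f. bounded_linear f \<and> (\<forall>c x. f (c *\<^sub>C x) = c *\<^sub>C f x)}"
    by (auto intro!: bounded_linear_intro[where K = K] simp: scaleR_scaleC)
  then have "Abs_cblinfun g *\<^sub>V a = g a" for a
    by (simp add: Abs_cblinfun_inverse)
  moreover have "g (v i) = w i" for i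
  proof (rule R_unique[OF g])
    have "(v i, w i) \<in> G"
      unfolding G_def mem_Collect_eq by (intro exI[of _ "{i}"] exI[of _ "\<lambda>_. 1"]) simp
    then show "R (v i) (w i)"
      unfolding R_def by (intro exI[of _ "\<lambda>_. v i"] exI[of _ "\<lambda>_. w i"]) simp
  qed
  ultimately show ?thesis
    by (intro exI[of _ "Abs_cblinfun g"]) simp
qed

lemma has_sum_finite_sum:
  fixes f :: "'i \<Rightarrow> 'j \<Rightarrow> 'a::topological_comm_monoid_add"
  assumes "finite F" "\<And>i. i \<in> F \<Longrightarrow> (f i has_sum s i) A"
  shows "((\<lambda>j. \<Sum>i\<in>F. f i j) has_sum (\<Sum>i\<in>F. s i)) A"
  using assms by (induction F rule: finite_induct) (auto intro: has_sum_add)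

lemma norm_sum_tensor_left:
  assumes "finite F" and B: "is_onb B"
  shows "((\<lambda>b. (norm (\<Sum>i\<in>F. cinner (y i) b *\<^sub>C x i))\<^sup>2) has_sum
    (norm (\<Sum>i\<in>F. x i \<otimes>\<^sub>v y i))\<^sup>2) B"
proof -
  have "((\<lambda>b. \<Sum>i\<in>F. \<Sum>j\<in>F. cinner (x i) (x j) * (cinner (y i) b * cinner b (y j))) has_sum
      (\<Sum>i\<in>F. \<Sum>j\<in>F. cinner (x i) (x j) * cinner (y i) (y j))) B"
    by (intro has_sum_finite_sum assms has_sum_cmult_right parseval)
  moreover have "(\<Sum>i\<in>F. \<Sum>j\<in>F. cinner (x i) (x j) * cinner (y i) (y j)) =
      complex_of_real ((norm (\<Sum>i\<in>F. x i \<otimes>\<^sub>v y i))\<^sup>2)"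
    unfolding cinner_self[symmetric] cinner_sum_left cinner_sum_right cinner_tensor_vec
    by (rule sum.swap)
  moreover have "(\<Sum>i\<in>F. \<Sum>j\<in>F. cinner (x i) (x j) * (cinner (y i) b * cinner b (y j))) =
      complex_of_real ((norm (\<Sum>i\<in>F. cinner (y i) b *\<^sub>C x i))\<^sup>2)" for b
    unfolding cinner_self[symmetric] cinner_sum_left cinner_sum_right
    by (subst sum.swap) (intro sum.cong refl, simp add: cinner_commute[of b])
  ultimately show ?thesis
    using has_sum_Re by fastforce
qed

lemma norm_sum_tensor_right:
  assumes "finite F" and B: "is_onb B"
  shows "((\<lambda>b. (norm (\<Sum>i\<in>F. cinner (x i) b *\<^sub>C y i))\<^sup>2) has_sum
    (norm (\<Sum>i\<in>F. x i \<otimes>\<^sub>v y i))\<^sup>2) B"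
proof -
  have "cinner (\<Sum>i\<in>F. x i \<otimes>\<^sub>v y i) (\<Sum>i\<in>F. x i \<otimes>\<^sub>v y i) =
      cinner (\<Sum>i\<in>F. y i \<otimes>\<^sub>v x i) (\<Sum>i\<in>F. y i \<otimes>\<^sub>v x i)"
    unfolding cinner_sum_left cinner_sum_right cinner_tensor_vec
    by (intro sum.cong refl) (rule mult.commute)
  then have "(norm (\<Sum>i\<in>F. x i \<otimes>\<^sub>v y i))\<^sup>2 = (norm (\<Sum>i\<in>F. y i \<otimes>\<^sub>v x i))\<^sup>2"
    unfolding cinner_self of_real_eq_iff .
  then show ?thesis
    using norm_sum_tensor_left[OF assms, where x = y and y = x] by simp
qed

lemma cblinfun_apply_sum_scaleC:
  "X *\<^sub>V (\<Sum>i\<in>F. c i *\<^sub>C x i) = (\<Sum>i\<in>F. c i *\<^sub>C (X *\<^sub>V x i))"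
  by (simp add: linear_sum[OF bounded_linear.linear[OF bounded_linear_cblinfun_apply]])

lemma norm_tensor_op_left_le:
  assumes "finite F"
  shows "norm (\<Sum>i\<in>F. (X *\<^sub>V x i) \<otimes>\<^sub>v y i) \<le> norm X * norm (\<Sum>i\<in>F. x i \<otimes>\<^sub>v y i)"
proof (rule power2_le_imp_le)
  have "(norm (\<Sum>i\<in>F. (X *\<^sub>V x i) \<otimes>\<^sub>v y i))\<^sup>2 \<le> (norm X)\<^sup>2 * (norm (\<Sum>i\<in>F. x i \<otimes>\<^sub>v y i))\<^sup>2"
  proof (rule has_sum_mono[OF norm_sum_tensor_left has_sum_cmult_right[OF norm_sum_tensor_left]])
    fix b
    show "(norm (\<Sum>i\<in>F. cinner (y i) b *\<^sub>C (X *\<^sub>V x i)))\<^sup>2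
        \<le> (norm X)\<^sup>2 * (norm (\<Sum>i\<in>F. cinner (y i) b *\<^sub>C x i))\<^sup>2"
      unfolding cblinfun_apply_sum_scaleC[symmetric] power_mult_distrib[symmetric]
      by (intro power_mono norm_cblinfun_apply_le) simp
  qed (rule assms is_onb_some_onb)+
  then show "(norm (\<Sum>i\<in>F. (X *\<^sub>V x i) \<otimes>\<^sub>v y i))\<^sup>2 \<le> (norm X * norm (\<Sum>i\<in>F. x i \<otimes>\<^sub>v y i))\<^sup>2"
    by (simp only: power_mult_distrib)
qed simp

lemma norm_tensor_op_right_le:
  assumes "finite F"
  shows "norm (\<Sum>i\<in>F. x i \<otimes>\<^sub>v (Y *\<^sub>V y i)) \<le> norm Y * norm (\<Sum>i\<in>F. x i \<otimes>\<^sub>v y i)"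
proof (rule power2_le_imp_le)
  have "(norm (\<Sum>i\<in>F. x i \<otimes>\<^sub>v (Y *\<^sub>V y i)))\<^sup>2 \<le> (norm Y)\<^sup>2 * (norm (\<Sum>i\<in>F. x i \<otimes>\<^sub>v y i))\<^sup>2"
  proof (rule has_sum_mono[OF norm_sum_tensor_right has_sum_cmult_right[OF norm_sum_tensor_right]])
    fix b
    show "(norm (\<Sum>i\<in>F. cinner (x i) b *\<^sub>C (Y *\<^sub>V y i)))\<^sup>2
        \<le> (norm Y)\<^sup>2 * (norm (\<Sum>i\<in>F. cinner (x i) b *\<^sub>C y i))\<^sup>2"
      unfolding cblinfun_apply_sum_scaleC[symmetric] power_mult_distrib[symmetric]
      by (intro power_mono norm_cblinfun_apply_le) simp
  qed (rule assms is_onb_some_onb)+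
  then show "(norm (\<Sum>i\<in>F. x i \<otimes>\<^sub>v (Y *\<^sub>V y i)))\<^sup>2 \<le> (norm Y * norm (\<Sum>i\<in>F. x i \<otimes>\<^sub>v y i))\<^sup>2"
    by (simp only: power_mult_distrib)
qed simp

lemma tensor_op_bound:
  assumes "finite F"
  shows "norm (\<Sum>i\<in>F. c i *\<^sub>C ((X *\<^sub>V x i) \<otimes>\<^sub>v (Y *\<^sub>V y i)))
    \<le> norm X * norm Y * norm (\<Sum>i\<in>F. c i *\<^sub>C (x i \<otimes>\<^sub>v y i))"
proof -
  have "norm (\<Sum>i\<in>F. (X *\<^sub>V c i *\<^sub>C x i) \<otimes>\<^sub>v (Y *\<^sub>V y i))
      \<le> norm X * norm (\<Sum>i\<in>F. (c i *\<^sub>C x i) \<otimes>\<^sub>v (Y *\<^sub>V y i))"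
    by (rule norm_tensor_op_left_le[OF assms])
  also have "\<dots> \<le> norm X * (norm Y * norm (\<Sum>i\<in>F. (c i *\<^sub>C x i) \<otimes>\<^sub>v y i))"
    by (intro mult_left_mono norm_tensor_op_right_le[OF assms]) simp
  finally show ?thesis
    by (simp add: tensor_vec_scaleC_left mult.assoc)
qed

lemma htensor_op_eqI:
  fixes Z :: "(('a::chilbert_space, 'b::chilbert_space) htensor, 'c::complex_inner) cblinfun"
  assumes "\<And>x y. Z *\<^sub>V x \<otimes>\<^sub>v y = Z' *\<^sub>V x \<otimes>\<^sub>v y"
  shows "Z = Z'"
proof (rule cblinfun_eqI)
  fix u
  let ?S = "{x \<otimes>\<^sub>v y | (x::'a) (y::'b). True}"
  have "Z *\<^sub>V w = Z' *\<^sub>V w" if "w \<in> cspan ?S" for w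
    using that by (induction rule: complex_vector.span_induct_alt)
      (auto simp: assms cblinfun_apply_add linear_0[OF bounded_linear.linear[OF bounded_linear_cblinfun_apply]])
  then have "cspan ?S \<subseteq> {w. Z *\<^sub>V w = Z' *\<^sub>V w}"
    by blast
  moreover have "closed {w. Z *\<^sub>V w = Z' *\<^sub>V w}"
    by (intro closed_Collect_eq bounded_linear.continuous_on[OF bounded_linear_cblinfun_apply]
        continuous_on_id)
  ultimately have "closure (cspan ?S) \<subseteq> {w. Z *\<^sub>V w = Z' *\<^sub>V w}"
    by (rule closure_minimal)
  then show "Z *\<^sub>V u = Z' *\<^sub>V u"
    unfolding closure_cspan_tensor_vec by blast
qed

lemma tensor_op_apply: "(X \<otimes>\<^sub>o Y) *\<^sub>V x \<otimes>\<^sub>v y = (X *\<^sub>V x) \<otimes>\<^sub>v (Y *\<^sub>V y)"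
proof -
  define P where "P Z \<longleftrightarrow> (\<forall>x y. Z *\<^sub>V x \<otimes>\<^sub>v y = (X *\<^sub>V x) \<otimes>\<^sub>v (Y *\<^sub>V y))" for Z
  have range_eq: "range (\<lambda>(x, y). x \<otimes>\<^sub>v y) = {x \<otimes>\<^sub>v y | x y. True}"
    by auto
  have "\<exists>Z. \<forall>p. Z *\<^sub>V (case p of (x, y) \<Rightarrow> x \<otimes>\<^sub>v y) =
      (case p of (x, y) \<Rightarrow> (X *\<^sub>V x) \<otimes>\<^sub>v (Y *\<^sub>V y))"
  proof (rule cblinfun_extension[where K = "norm X * norm Y"])
    show "closure (cspan (range (\<lambda>(x, y). x \<otimes>\<^sub>v y))) = UNIV"
      unfolding range_eq by (rule closure_cspan_tensor_vec)
  qed (simp_all add: case_prod_unfold tensor_op_bound)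
  then have "\<exists>Z. P Z"
    by (auto simp: P_def)
  moreover have "Z = Z'" if "P Z" "P Z'" for Z Z'
  proof (rule htensor_op_eqI)
    fix x y
    show "Z *\<^sub>V x \<otimes>\<^sub>v y = Z' *\<^sub>V x \<otimes>\<^sub>v y"
      using that by (simp add: P_def)
  qed
  ultimately have "\<exists>!Z. P Z"
    by (rule ex_ex1I)
  then have P: "P (X \<otimes>\<^sub>o Y)"
    unfolding tensor_op_def P_def[symmetric] by (rule theI')
  show ?thesis
    by (rule P[unfolded P_def, rule_format])
qed

section \<open>The full Fock space and the noncommutative analytic Toeplitz algebra\<close>

text \<open>For \<open>H\<^sub>n\<close> with orthonormal basis \<open>e\<^sub>i\<close> indexed by the finite type \<open>'n\<close>, the space
  \<open>H\<^sub>n\<^bsup>\<otimes>k\<^esup>\<close> has as orthonormal basis the tensors \<open>e\<^sub>\<alpha>\<close> with \<open>\<alpha>\<close> a word of length \<open>k\<close>, so the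
  Hilbert direct sum \<open>F\<^sup>2(H\<^sub>n)\<close> of all these spaces is the space of square-summable families of
  coordinates indexed by all words.  The free semigroup on \<open>'n\<close> is the type of lists over \<open>'n\<close>.\<close>

type_synonym 'n fock = "('n list, complex) ell2"

lift_definition fock_basis :: "'n list \<Rightarrow> 'n fock" is
  "\<lambda>\<alpha> \<beta>. if \<beta> = \<alpha> then 1 else 0"
proof -
  fix \<alpha> :: "'n list"
  show "(\<lambda>\<beta>. (cmod (if \<beta> = \<alpha> then 1 else 0))\<^sup>2) summable_on UNIV"
    by (rule finite_nonzero_values_imp_summable_on)
      (rule finite_subset[of _ "{\<alpha>}"], auto)
qed

text \<open>In coordinates, \<open>e\<^sub>i \<otimes> \<phi>\<close> is supported on the words starting with \<open>i\<close>.\<close>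

lift_definition creation_map :: "'n \<Rightarrow> 'n fock \<Rightarrow> 'n fock" is
  "\<lambda>i f \<beta>. case \<beta> of [] \<Rightarrow> 0 | j # \<gamma> \<Rightarrow> if j = i then f \<gamma> else 0"
proof -
  fix i :: 'n and f :: "'n list \<Rightarrow> complex"
  let ?g = "\<lambda>\<beta>. case \<beta> of [] \<Rightarrow> 0 | j # \<gamma> \<Rightarrow> if j = i then f \<gamma> else 0"
  assume "(\<lambda>\<alpha>. (cmod (f \<alpha>))\<^sup>2) summable_on UNIV"
  then have "(\<lambda>\<beta>. (cmod (?g \<beta>))\<^sup>2) summable_on range (Cons i)"
    by (subst summable_on_reindex) (auto simp: comp_def)
  then show "(\<lambda>\<beta>. (cmod (?g \<beta>))\<^sup>2) summable_on UNIV"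
    by (rule summable_on_cong_neutral[THEN iffD1, rotated -1]) (auto split: list.splits)
qed

lemma norm_creation_map: "norm (creation_map i f) = norm f"
proof -
  have "((\<lambda>\<beta>. (norm (Rep_ell2 (creation_map i f) \<beta>))\<^sup>2) has_sum (norm f)\<^sup>2) (range (Cons i))"
    using norm_ell2_has_sum[of f] by (subst has_sum_reindex) (auto simp: comp_def creation_map.rep_eq)
  then have "((\<lambda>\<beta>. (norm (Rep_ell2 (creation_map i f) \<beta>))\<^sup>2) has_sum (norm f)\<^sup>2) UNIV"
    by (rule has_sum_cong_neutral[THEN iffD1, rotated -1])
      (auto simp: creation_map.rep_eq split: list.splits)
  then have "(norm (creation_map i f))\<^sup>2 = (norm f)\<^sup>2"
    by (rule has_sum_unique[OF norm_ell2_has_sum])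
  then show ?thesis
    by (simp add: power2_eq_iff_nonneg)
qed

lift_definition creation :: "'n \<Rightarrow> 'n fock operator" is creation_map
proof (intro conjI allI)
  fix i :: 'n
  have scale: "creation_map i (c *\<^sub>C f) = c *\<^sub>C creation_map i f" for c f
    by transfer (auto simp: fun_eq_iff scaleC_complex_def split: list.splits)
  then show "creation_map i (c *\<^sub>C f) = c *\<^sub>C creation_map i f" for c f .
  have "creation_map i (f + g) = creation_map i f + creation_map i g" for f g
    by transfer (auto simp: fun_eq_iff split: list.splits)
  then show "bounded_linear (creation_map i)"
    by (intro bounded_linear_intro[where K = 1]) (simp_all add: scaleR_scaleC scale norm_creation_map)
qed

lemma creation_fock_basis: "creation i *\<^sub>V fock_basis \<alpha> = fock_basis (i # \<alpha>)"
  by (rule Rep_ell2_inject[THEN iffD1])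
    (auto simp: creation.rep_eq creation_map.rep_eq fock_basis.rep_eq fun_eq_iff split: list.splits)

primrec word_op :: "('n \<Rightarrow> 'a::complex_inner operator) \<Rightarrow> 'n list \<Rightarrow> 'a operator" where
  "word_op T [] = id_op"
| "word_op T (i # \<alpha>) = T i \<bullet>\<^sub>o word_op T \<alpha>"

definition wot :: "'a::complex_inner operator topology" where
  "wot = topology_generated_by {{X. cinner (X *\<^sub>V x) y \<in> U} | x y U. open U}"

definition op_subalgebra :: "'a::complex_inner operator set \<Rightarrow> bool" where
  "op_subalgebra M \<longleftrightarrow> 0 \<in> M \<and> (\<forall>X\<in>M. \<forall>Y\<in>M. X + Y \<in> M \<and> X \<bullet>\<^sub>o Y \<in> M) \<and>
    (\<forall>c. \<forall>X\<in>M. c *\<^sub>C X \<in> M)"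

definition wot_closed_algebra :: "'a::complex_inner operator set \<Rightarrow> 'a operator set" where
  "wot_closed_algebra G = \<Inter>{M. op_subalgebra M \<and> closedin wot M \<and> G \<subseteq> M}"

definition nc_toeplitz :: "'n fock operator set" where
  "nc_toeplitz = wot_closed_algebra (insert id_op (range creation))"

definition spatial_tensor :: "'a::chilbert_space operator set \<Rightarrow> 'b::chilbert_space operator set
    \<Rightarrow> ('a, 'b) htensor operator set" where
  "spatial_tensor M N = closure (module.span scaleC {X \<otimes>\<^sub>o Y | X Y. X \<in> M \<and> Y \<in> N})"

definition nc_toeplitz_tensor :: "('n fock, 'h::chilbert_space) htensor operator set" where
  "nc_toeplitz_tensor = wot_closed_algebra (spatial_tensor nc_toeplitz UNIV)"

definition fourier_coefficients ::
  "('n fock, 'h::chilbert_space) htensor operator \<Rightarrow> ('n list \<Rightarrow> 'h operator) \<Rightarrow> bool" where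
  "fourier_coefficients F A \<longleftrightarrow> (\<forall>\<alpha> h h'.
    cinner (A \<alpha> *\<^sub>V h) h' = cinner (F *\<^sub>V fock_basis [] \<otimes>\<^sub>v h) (fock_basis \<alpha> \<otimes>\<^sub>v h'))"

end

theory Submission
  imports Defs
begin

text \<open>Every element of the tensored algebra commutes with the right creation operators, so \<open>F\<close> is a
  multi-analytic Toeplitz matrix: \<open>F(e\<^sub>\<beta> \<otimes> h)\<close> is the shift of \<open>F(1 \<otimes> h)\<close> by \<open>\<beta>\<close>. For fixed \<open>k \<ge> 1\<close>,
  testing \<open>Re F \<le> I\<close> on \<open>1 \<otimes> h + \<Sum>\<^bsub>|\<alpha>|=k\<^esub> e\<^sub>\<alpha> \<otimes> x\<^sub>\<alpha>\<close> therefore gives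
  \<open>Re \<Sum> \<langle>A\<^sub>\<alpha> h, x\<^sub>\<alpha>\<rangle> \<le> \<parallel>I - A\<^sub>0\<parallel> (\<parallel>h\<parallel>\<^sup>2 + \<Sum> \<parallel>x\<^sub>\<alpha>\<parallel>\<^sup>2)\<close>, and optimising over multiples \<open>x\<^sub>\<alpha>\<close> of \<open>A\<^sub>\<alpha> h\<close>
  bounds the column of the \<open>A\<^sub>\<alpha>\<close> by \<open>2 \<parallel>I - A\<^sub>0\<parallel>\<close>. The row of the \<open>T\<^sub>\<alpha>\<close> has norm at most
  \<open>3\<^sup>-\<^sup>k\<close>, so the \<open>k\<close>-th term of the series is at most \<open>2 \<cdot> 3\<^sup>-\<^sup>k \<parallel>I - A\<^sub>0\<parallel>\<close>, which sums to
  \<open>\<parallel>I - A\<^sub>0\<parallel>\<close>.\<close>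

subsection \<open>Operators\<close>

lemma bounded_linear_apply_cblinfun: "bounded_linear (\<lambda>X. X *\<^sub>V x)"
  by (rule bounded_linear_intro[where K = "norm x"])
    (simp_all add: plus_cblinfun.rep_eq scaleR_cblinfun.rep_eq norm_cblinfun_apply_le)

lemma cblinfun_sum_apply: "(\<Sum>i\<in>I. X i) *\<^sub>V x = (\<Sum>i\<in>I. X i *\<^sub>V x)"
  by (rule linear_sum[OF bounded_linear.linear[OF bounded_linear_apply_cblinfun]])

lemma cblinfun_apply_zero [simp]: "X *\<^sub>V 0 = 0"
  by (rule linear_0[OF bounded_linear.linear[OF bounded_linear_cblinfun_apply]])

lemma cinner_adj_left: "cinner (adj X *\<^sub>V y) x = cinner y (X *\<^sub>V x)"
  by (metis cinner_adj cinner_commute)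

lemma adj_eqI: "(\<And>x y. cinner (X *\<^sub>V x) y = cinner x (Y *\<^sub>V y)) \<Longrightarrow> adj X = Y"
  by (rule cblinfun_eqI, rule cinner_ext_right) (simp flip: cinner_adj)

lemma adj_adj [simp]: "adj (adj X) = X"
  by (rule adj_eqI) (rule cinner_adj_left)

lemma adj_comp_op: "adj (X \<bullet>\<^sub>o Y) = adj Y \<bullet>\<^sub>o adj X"
  by (rule adj_eqI) (simp add: comp_op.rep_eq cinner_adj)

lemma adj_id_op [simp]: "adj id_op = id_op"
  by (rule adj_eqI) (simp add: id_op.rep_eq)

lemma comp_id_op [simp]: "id_op \<bullet>\<^sub>o X = X" "X \<bullet>\<^sub>o id_op = X"
  by (rule cblinfun_eqI, simp add: comp_op.rep_eq id_op.rep_eq)+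

lemma norm_id_op_le: "norm (id_op :: 'a::complex_inner operator) \<le> 1"
  by (rule norm_cblinfun_bound) (simp_all add: id_op.rep_eq)

text \<open>Testing with \<open>y\<close> equal to the image of \<open>x\<close> yields the square
  of the norm of that image, from which one factor cancels.\<close>

lemma norm_cblinfun_bound_cinner:
  assumes "0 \<le> K" "\<And>x y. cmod (cinner (X *\<^sub>V x) y) \<le> K * norm x * norm y"
  shows "norm X \<le> K"
proof (rule norm_cblinfun_bound[OF assms(1)])
  fix x
  have "norm (X *\<^sub>V x) * norm (X *\<^sub>V x) \<le> (K * norm x) * norm (X *\<^sub>V x)"
    using assms(2)[of x "X *\<^sub>V x"] by (simp add: cinner_self power2_eq_square norm_mult)
  then show "norm (X *\<^sub>V x) \<le> K * norm x"
    using assms(1) by (cases "norm (X *\<^sub>V x) = 0") (auto simp: mult_le_cancel_right)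
qed

section \<open>Norms of rows and columns of operators\<close>

lemma sum_norm_mult_le_sqrt:
  "(\<Sum>i\<in>I. norm (f i) * norm (g i)) \<le> sqrt (\<Sum>i\<in>I. (norm (f i))\<^sup>2) * sqrt (\<Sum>i\<in>I. (norm (g i))\<^sup>2)"
  using L2_set_mult_ineq[of "\<lambda>i. norm (f i)" "\<lambda>i. norm (g i)" I] by (simp add: L2_set_def)

text \<open>The left-hand side is the quadratic form at \<open>h\<close> of the operator inside the
  norm on the right.\<close>

lemma sum_norm_power2_le_norm_column:
  "(\<Sum>i\<in>I. (norm (X i *\<^sub>V h))\<^sup>2) \<le> norm (\<Sum>i\<in>I. adj (X i) \<bullet>\<^sub>o X i) * (norm h)\<^sup>2"
proof -
  have "complex_of_real (\<Sum>i\<in>I. (norm (X i *\<^sub>V h))\<^sup>2) = cinner ((\<Sum>i\<in>I. adj (X i) \<bullet>\<^sub>o X i) *\<^sub>V h) h"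
    by (simp add: cblinfun_sum_apply cinner_sum_left comp_op.rep_eq cinner_adj_left cinner_self)
  then have "(\<Sum>i\<in>I. (norm (X i *\<^sub>V h))\<^sup>2) = Re (cinner ((\<Sum>i\<in>I. adj (X i) \<bullet>\<^sub>o X i) *\<^sub>V h) h)"
    by (metis Re_complex_of_real)
  also have "\<dots> \<le> norm (\<Sum>i\<in>I. adj (X i) \<bullet>\<^sub>o X i) * norm h * norm h"
    by (rule order_trans[OF complex_Re_le_cmod cmod_cinner_cblinfun_le])
  finally show ?thesis
    by (simp add: power2_eq_square mult.assoc)
qed

text \<open>Converse of the preceding estimate. Cauchy-Schwarz, first in the space and then over
  \<open>I\<close>, bounds the whole sesquilinear form, so numerical radii of self-adjoint operators
  are avoided.\<close>

lemma norm_column_le: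
  assumes "0 \<le> K" "\<And>h. (\<Sum>i\<in>I. (norm (X i *\<^sub>V h))\<^sup>2) \<le> K * (norm h)\<^sup>2"
  shows "norm (\<Sum>i\<in>I. adj (X i) \<bullet>\<^sub>o X i) \<le> K"
proof (rule norm_cblinfun_bound_cinner[OF assms(1)])
  fix x y
  have sqrt_le: "sqrt (\<Sum>i\<in>I. (norm (X i *\<^sub>V h))\<^sup>2) \<le> sqrt K * norm h" for h
    using real_sqrt_le_mono[OF assms(2)[of h]] by (simp add: real_sqrt_mult)
  have "cmod (cinner ((\<Sum>i\<in>I. adj (X i) \<bullet>\<^sub>o X i) *\<^sub>V x) y)
      = cmod (\<Sum>i\<in>I. cinner (X i *\<^sub>V x) (X i *\<^sub>V y))"
    by (simp add: cblinfun_sum_apply cinner_sum_left comp_op.rep_eq cinner_adj_left)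
  also have "\<dots> \<le> (\<Sum>i\<in>I. norm (X i *\<^sub>V x) * norm (X i *\<^sub>V y))"
    by (intro order_trans[OF norm_sum] sum_mono cmod_cinner_le)
  also have "\<dots> \<le> (sqrt K * norm x) * (sqrt K * norm y)"
    by (intro order_trans[OF sum_norm_mult_le_sqrt] mult_mono sqrt_le)
      (simp_all add: sum_nonneg assms(1))
  also have "\<dots> = K * norm x * norm y"
    using assms(1) by (simp add: mult_ac)
  finally show "cmod (cinner ((\<Sum>i\<in>I. adj (X i) \<bullet>\<^sub>o X i) *\<^sub>V x) y) \<le> K * norm x * norm y" .
qed

subsection \<open>Tensor products of operators\<close>

lemma htensor_eqI:
  fixes u v :: "('a::chilbert_space, 'b::chilbert_space) htensor"
  assumes "\<And>x y. cinner (x \<otimes>\<^sub>v y) u = cinner (x \<otimes>\<^sub>v y) v"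
  shows "u = v"
proof (rule cinner_ext_right)
  fix z :: "('a, 'b) htensor"
  have "z \<in> closure (cspan {x \<otimes>\<^sub>v y | x y. True})"
    unfolding closure_cspan_tensor_vec by (rule UNIV_I)
  then have "cinner z (u - v) = 0"
    by (rule cinner_eq_0_closure_cspan) (auto simp: cinner_diff_right assms)
  then show "cinner z u = cinner z v"
    by (simp add: cinner_diff_right)
qed

lemma adj_tensor_op: "adj (X \<otimes>\<^sub>o Y) = adj X \<otimes>\<^sub>o adj Y"
  by (rule htensor_op_eqI, rule htensor_eqI)
    (simp add: tensor_op_apply cinner_tensor_vec flip: cinner_adj)

lemma tensor_op_comp: "(X \<otimes>\<^sub>o Y) \<bullet>\<^sub>o (X' \<otimes>\<^sub>o Y') = (X \<bullet>\<^sub>o X') \<otimes>\<^sub>o (Y \<bullet>\<^sub>o Y')"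
  by (rule htensor_op_eqI) (simp add: tensor_op_apply comp_op.rep_eq)

lemma tensor_vec_zero_left [simp]: "0 \<otimes>\<^sub>v y = 0"
  using tensor_vec_scaleC_left[of 0 0 y] by simp

lemma tensor_vec_zero_right [simp]: "x \<otimes>\<^sub>v 0 = 0"
  using tensor_vec_scaleC_right[of x 0 0] by simp

lemma tensor_vec_sum_left: "(\<Sum>i\<in>I. x i) \<otimes>\<^sub>v y = (\<Sum>i\<in>I. x i \<otimes>\<^sub>v y)"
  by (induction I rule: infinite_finite_induct) (simp_all add: tensor_vec_add_left)

lemma tensor_vec_sum_right: "x \<otimes>\<^sub>v (\<Sum>i\<in>I. y i) = (\<Sum>i\<in>I. x \<otimes>\<^sub>v y i)"
  by (induction I rule: infinite_finite_induct) (simp_all add: tensor_vec_add_right)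

lemma tensor_op_sum_left: "(\<Sum>i\<in>I. X i) \<otimes>\<^sub>o Y = (\<Sum>i\<in>I. X i \<otimes>\<^sub>o Y)"
  by (rule htensor_op_eqI) (simp add: tensor_op_apply cblinfun_sum_apply tensor_vec_sum_left)

lemma tensor_op_sum_right: "X \<otimes>\<^sub>o (\<Sum>i\<in>I. Y i) = (\<Sum>i\<in>I. X \<otimes>\<^sub>o Y i)"
  by (rule htensor_op_eqI) (simp add: tensor_op_apply cblinfun_sum_apply tensor_vec_sum_right)

text \<open>The inequality is known on finite combinations of elementary tensors; these are dense,
  and the vectors satisfying it form a closed set.\<close>

lemma norm_tensor_op_le:
  fixes X :: "'a::chilbert_space operator" and Y :: "'b::chilbert_space operator"
  shows "norm (X \<otimes>\<^sub>o Y) \<le> norm X * norm Y"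
proof (rule norm_cblinfun_bound)
  fix u :: "('a, 'b) htensor"
  let ?v = "\<lambda>(x::'a, y::'b). x \<otimes>\<^sub>v y"
  let ?L = "{w. norm ((X \<otimes>\<^sub>o Y) *\<^sub>V w) \<le> norm X * norm Y * norm w}"
  have range_eq: "range ?v = {x \<otimes>\<^sub>v y | x y. True}"
    by auto
  have "w \<in> ?L" if w: "w \<in> cspan (range ?v)" for w
  proof -
    obtain G c where G: "finite G" "w = (\<Sum>p\<in>G. c p *\<^sub>C ?v p)"
      using cspan_range_sum[OF w] by blast
    show ?thesis
      using tensor_op_bound[OF G(1), of c X fst Y snd]
      by (simp add: G(2) cblinfun_apply_sum_scaleC case_prod_unfold tensor_op_apply)
  qed
  then have "closure (cspan (range ?v)) \<subseteq> ?L"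
    by (intro closure_minimal subsetI closed_Collect_le continuous_intros
        bounded_linear.continuous_on[OF bounded_linear_cblinfun_apply])
  then show "norm ((X \<otimes>\<^sub>o Y) *\<^sub>V u) \<le> norm X * norm Y * norm u"
    unfolding range_eq closure_cspan_tensor_vec by blast
qed simp

text \<open>The sum factors as the row of the \<open>X i\<close> tensored with the identity, times
  the column of the identity tensored with the \<open>Y i\<close>. Each factor contributes one
  square root.\<close>

lemma norm_sum_tensor_op_le:
  fixes X :: "'i \<Rightarrow> 'a::chilbert_space operator" and Y :: "'i \<Rightarrow> 'b::chilbert_space operator"
  shows "norm (\<Sum>i\<in>I. X i \<otimes>\<^sub>o Y i)
    \<le> sqrt (norm (\<Sum>i\<in>I. X i \<bullet>\<^sub>o adj (X i))) * sqrt (norm (\<Sum>i\<in>I. adj (Y i) \<bullet>\<^sub>o Y i))"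
    (is "_ \<le> sqrt ?K * sqrt ?L")
proof (rule norm_cblinfun_bound_cinner)
  fix u v :: "('a, 'b) htensor"
  \<comment> \<open>The adjoint makes \<open>?X\<close> a column as well, so that a single column
    estimate serves both factors.\<close>
  let ?X = "\<lambda>i. adj (X i) \<otimes>\<^sub>o (id_op :: 'b operator)" and ?Y = "\<lambda>i. (id_op :: 'a operator) \<otimes>\<^sub>o Y i"
  have X: "sqrt (\<Sum>i\<in>I. (norm (?X i *\<^sub>V v))\<^sup>2) \<le> sqrt ?K * norm v"
  proof -
    have "(\<Sum>i\<in>I. adj (?X i) \<bullet>\<^sub>o ?X i) = (\<Sum>i\<in>I. X i \<bullet>\<^sub>o adj (X i)) \<otimes>\<^sub>o id_op"
      by (simp add: adj_tensor_op tensor_op_comp tensor_op_sum_left)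
    then have "norm (\<Sum>i\<in>I. adj (?X i) \<bullet>\<^sub>o ?X i) \<le> ?K"
      using norm_tensor_op_le[of "\<Sum>i\<in>I. X i \<bullet>\<^sub>o adj (X i)" "id_op :: 'b operator"]
        mult_left_mono[OF norm_id_op_le[where 'a = 'b], of ?K] by simp
    then have "(\<Sum>i\<in>I. (norm (?X i *\<^sub>V v))\<^sup>2) \<le> ?K * (norm v)\<^sup>2"
      by (intro order_trans[OF sum_norm_power2_le_norm_column] mult_right_mono) simp_all
    then show ?thesis
      using real_sqrt_le_mono by (fastforce simp: real_sqrt_mult)
  qed
  have Y: "sqrt (\<Sum>i\<in>I. (norm (?Y i *\<^sub>V u))\<^sup>2) \<le> sqrt ?L * norm u"
  proof -
    have "(\<Sum>i\<in>I. adj (?Y i) \<bullet>\<^sub>o ?Y i) = id_op \<otimes>\<^sub>o (\<Sum>i\<in>I. adj (Y i) \<bullet>\<^sub>o Y i)"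
      by (simp add: adj_tensor_op tensor_op_comp tensor_op_sum_right)
    then have "norm (\<Sum>i\<in>I. adj (?Y i) \<bullet>\<^sub>o ?Y i) \<le> ?L"
      using norm_tensor_op_le[of "id_op :: 'a operator" "\<Sum>i\<in>I. adj (Y i) \<bullet>\<^sub>o Y i"]
        mult_right_mono[OF norm_id_op_le[where 'a = 'a], of ?L] by simp
    then have "(\<Sum>i\<in>I. (norm (?Y i *\<^sub>V u))\<^sup>2) \<le> ?L * (norm u)\<^sup>2"
      by (intro order_trans[OF sum_norm_power2_le_norm_column] mult_right_mono) simp_all
    then show ?thesis
      using real_sqrt_le_mono by (fastforce simp: real_sqrt_mult)
  qed
  have factor: "X i \<otimes>\<^sub>o Y i = adj (?X i) \<bullet>\<^sub>o ?Y i" for i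
    by (simp add: adj_tensor_op tensor_op_comp)
  have "cmod (cinner ((\<Sum>i\<in>I. X i \<otimes>\<^sub>o Y i) *\<^sub>V u) v) = cmod (\<Sum>i\<in>I. cinner (?Y i *\<^sub>V u) (?X i *\<^sub>V v))"
    unfolding factor by (simp add: cblinfun_sum_apply cinner_sum_left comp_op.rep_eq cinner_adj_left)
  also have "\<dots> \<le> (\<Sum>i\<in>I. norm (?Y i *\<^sub>V u) * norm (?X i *\<^sub>V v))"
    by (intro order_trans[OF norm_sum] sum_mono cmod_cinner_le)
  also have "\<dots> \<le> (sqrt ?L * norm u) * (sqrt ?K * norm v)"
    by (intro order_trans[OF sum_norm_mult_le_sqrt] mult_mono X Y) (simp_all add: sum_nonneg)
  finally show "cmod (cinner ((\<Sum>i\<in>I. X i \<otimes>\<^sub>o Y i) *\<^sub>V u) v) \<le> sqrt ?K * sqrt ?L * norm u * norm v"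
    by (simp add: mult_ac)
qed simp

section \<open>Rows of products along words\<close>

lemma sum_lists_Suc_length:
  fixes f :: "'n::finite list \<Rightarrow> 'a::comm_monoid_add"
  shows "(\<Sum>\<alpha> | length \<alpha> = Suc k. f \<alpha>) = (\<Sum>i\<in>UNIV. \<Sum>\<alpha> | length \<alpha> = k. f (i # \<alpha>))"
proof -
  have "(\<Sum>\<alpha> | length \<alpha> = Suc k. f \<alpha>) = (\<Sum>(i, \<alpha>)\<in>UNIV \<times> {\<alpha>. length \<alpha> = k}. f (i # \<alpha>))"
    by (rule sum.reindex_bij_witness[where i = "\<lambda>(i, \<alpha>). i # \<alpha>" and j = "\<lambda>\<alpha>. (hd \<alpha>, tl \<alpha>)"])
      (auto simp: length_Suc_conv)
  then show ?thesis
    by (simp add: sum.cartesian_product)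
qed

text \<open>The row is estimated through the column of its adjoints. The adjoint of a word applies
  the adjoint of its first letter first, so each letter costs one factor \<open>c\<close>.\<close>

lemma norm_row_word_op_le:
  fixes T :: "'n::finite \<Rightarrow> 'k::chilbert_space operator"
  defines "c \<equiv> norm (\<Sum>i\<in>UNIV. T i \<bullet>\<^sub>o adj (T i))"
  shows "norm (\<Sum>\<alpha> | length \<alpha> = k. word_op T \<alpha> \<bullet>\<^sub>o adj (word_op T \<alpha>)) \<le> c ^ k"
proof -
  have c: "0 \<le> c"
    by (simp add: c_def)
  have "(\<Sum>\<alpha> | length \<alpha> = k. (norm (adj (word_op T \<alpha>) *\<^sub>V v))\<^sup>2) \<le> c ^ k * (norm v)\<^sup>2" for v
  \<comment> \<open>The induction hypothesis is needed at the vectors \<open>adj (T i)\<close>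
    applied to \<open>v\<close>.\<close>
  proof (induction k arbitrary: v)
    case 0
    then show ?case
      by (simp add: id_op.rep_eq)
  next
    case (Suc k)
    have "(\<Sum>\<alpha> | length \<alpha> = Suc k. (norm (adj (word_op T \<alpha>) *\<^sub>V v))\<^sup>2)
        = (\<Sum>i\<in>UNIV. \<Sum>\<alpha> | length \<alpha> = k. (norm (adj (word_op T \<alpha>) *\<^sub>V adj (T i) *\<^sub>V v))\<^sup>2)"
      by (simp add: sum_lists_Suc_length adj_comp_op comp_op.rep_eq)
    also have "\<dots> \<le> (\<Sum>i\<in>UNIV. c ^ k * (norm (adj (T i) *\<^sub>V v))\<^sup>2)"
      by (intro sum_mono Suc)
    also have "\<dots> \<le> c ^ k * (c * (norm v)\<^sup>2)"
      unfolding sum_distrib_left[symmetric]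
      using sum_norm_power2_le_norm_column[of "\<lambda>i. adj (T i)" v UNIV] c
      by (intro mult_left_mono) (simp_all add: c_def)
    finally show ?case
      by (simp add: mult_ac)
  qed
  from norm_column_le[OF _ this] c show ?thesis
    by simp
qed

subsection \<open>Commutants\<close>

text \<open>An algebra that is closed both in \<open>wot\<close> and in norm, so it contains each
  algebra built in this development as soon as it contains the generators.\<close>

definition commutant :: "'a::complex_inner operator \<Rightarrow> 'a operator set" where
  "commutant R = {X. X \<bullet>\<^sub>o R = R \<bullet>\<^sub>o X}"

lemma commutant_iff: "X \<in> commutant R \<longleftrightarrow> (\<forall>x. X *\<^sub>V R *\<^sub>V x = R *\<^sub>V X *\<^sub>V x)"
  unfolding commutant_def by (auto intro!: cblinfun_eqI simp: comp_op.rep_eq) (metis comp_op.rep_eq)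

lemma op_subalgebra_commutant: "op_subalgebra (commutant R)"
  by (simp add: op_subalgebra_def commutant_iff plus_cblinfun.rep_eq zero_cblinfun.rep_eq
      comp_op.rep_eq scaleC_cblinfun.rep_eq cblinfun_apply_add)

lemma topspace_wot: "topspace wot = (UNIV :: 'a::complex_inner operator set)"
proof (rule UNIV_eq_I[symmetric])
  fix X :: "'a operator"
  \<comment> \<open>The choice \<open>U = UNIV\<close> makes a subbasic set the whole space.\<close>
  have "openin wot {X :: 'a operator. cinner (X *\<^sub>V 0) 0 \<in> UNIV}"
    unfolding wot_def by (rule topology_generated_by_Basis) blast
  then show "X \<in> topspace wot"
    using openin_subset by auto
qed

lemma continuous_map_wot_cinner: "continuous_map wot euclidean (\<lambda>X. cinner (X *\<^sub>V x) y)"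
proof -
  have "openin wot {X. cinner (X *\<^sub>V x) y \<in> U}" if "open U" for U
    unfolding wot_def by (rule topology_generated_by_Basis) (use that in blast)
  then show ?thesis
    by (simp add: continuous_map_def topspace_wot)
qed

text \<open>Moving \<open>R\<close> to the other side of the inner product by its adjoint turns
  commutation into equations between \<open>wot\<close>-continuous functions of
  \<open>X\<close>.\<close>

lemma closedin_wot_commutant: "closedin wot (commutant (R :: 'a::chilbert_space operator))"
proof -
  have "commutant R = (\<Inter>x. \<Inter>y. {X. cinner (X *\<^sub>V R *\<^sub>V x) y = cinner (X *\<^sub>V x) (adj R *\<^sub>V y)})"
    by (auto simp: commutant_iff cinner_adj[symmetric]) (rule cinner_ext, blast)
  moreover have "closedin wot {X. cinner (X *\<^sub>V R *\<^sub>V x) y = cinner (X *\<^sub>V x) (adj R *\<^sub>V y)}" for x y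
    using closedin_continuous_maps_eq[OF _ continuous_map_wot_cinner continuous_map_wot_cinner]
    by (fastforce simp: topspace_wot)
  ultimately show ?thesis
    by (auto intro!: closedin_INT)
qed

text \<open>The norm topology is needed because \<open>spatial_tensor\<close> is a norm
  closure.\<close>

lemma closed_commutant: "closed (commutant R)"
proof -
  have "closed {X. X *\<^sub>V R *\<^sub>V x = R *\<^sub>V X *\<^sub>V x}" for x
    by (intro closed_Collect_eq bounded_linear.continuous_on[OF bounded_linear_apply_cblinfun]
        bounded_linear.continuous_on[OF bounded_linear_cblinfun_apply] continuous_on_id)
  then have "closed {X. \<forall>x. X *\<^sub>V R *\<^sub>V x = R *\<^sub>V X *\<^sub>V x}"
    by (rule closed_Collect_all)
  then show ?thesis
    by (simp add: commutant_iff[symmetric])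
qed

lemma wot_closed_algebra_subset_commutant:
  fixes R :: "'a::chilbert_space operator"
  shows "G \<subseteq> commutant R \<Longrightarrow> wot_closed_algebra G \<subseteq> commutant R"
  unfolding wot_closed_algebra_def
  using op_subalgebra_commutant closedin_wot_commutant by blast

subsection \<open>Right creation operators\<close>

text \<open>The coordinates of \<phi> \<otimes> e_j: the mirror image of
  \<open>creation_map\<close>, supported on the words ending in \<open>j\<close>.\<close>

lift_definition right_creation_map :: "'n \<Rightarrow> 'n fock \<Rightarrow> 'n fock" is
  "\<lambda>j f \<beta>. if \<beta> \<noteq> [] \<and> last \<beta> = j then f (butlast \<beta>) else 0"
proof -
  fix j :: 'n and f :: "'n list \<Rightarrow> complex"
  let ?g = "\<lambda>\<beta>. if \<beta> \<noteq> [] \<and> last \<beta> = j then f (butlast \<beta>) else 0"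
  assume "(\<lambda>\<alpha>. (cmod (f \<alpha>))\<^sup>2) summable_on UNIV"
  then have "(\<lambda>\<beta>. (cmod (?g \<beta>))\<^sup>2) summable_on range (\<lambda>\<gamma>. \<gamma> @ [j])"
    by (subst summable_on_reindex) (auto simp: comp_def inj_on_def)
  then show "(\<lambda>\<beta>. (cmod (?g \<beta>))\<^sup>2) summable_on UNIV"
    by (rule summable_on_cong_neutral[THEN iffD1, rotated -1])
      (auto simp: image_iff, metis append_butlast_last_id)
qed

lemma norm_right_creation_map: "norm (right_creation_map j f) = norm f"
proof -
  have "((\<lambda>\<beta>. (norm (Rep_ell2 (right_creation_map j f) \<beta>))\<^sup>2) has_sum (norm f)\<^sup>2)
      (range (\<lambda>\<gamma>. \<gamma> @ [j]))"
    using norm_ell2_has_sum[of f]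
    by (subst has_sum_reindex) (auto simp: comp_def inj_on_def right_creation_map.rep_eq)
  then have "((\<lambda>\<beta>. (norm (Rep_ell2 (right_creation_map j f) \<beta>))\<^sup>2) has_sum (norm f)\<^sup>2) UNIV"
    by (rule has_sum_cong_neutral[THEN iffD1, rotated -1])
      (auto simp: right_creation_map.rep_eq image_iff, metis append_butlast_last_id)
  then have "(norm (right_creation_map j f))\<^sup>2 = (norm f)\<^sup>2"
    by (rule has_sum_unique[OF norm_ell2_has_sum])
  then show ?thesis
    by (simp add: power2_eq_iff_nonneg)
qed

lift_definition right_creation :: "'n \<Rightarrow> 'n fock operator" is right_creation_map
proof (intro conjI allI)
  fix j :: 'n
  have scale: "right_creation_map j (c *\<^sub>C f) = c *\<^sub>C right_creation_map j f" for c f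
    by transfer (auto simp: fun_eq_iff scaleC_complex_def)
  then show "right_creation_map j (c *\<^sub>C f) = c *\<^sub>C right_creation_map j f" for c f .
  have "right_creation_map j (f + g) = right_creation_map j f + right_creation_map j g" for f g
    by transfer (auto simp: fun_eq_iff)
  then show "bounded_linear (right_creation_map j)"
    by (intro bounded_linear_intro[where K = 1])
      (simp_all add: scaleR_scaleC scale norm_right_creation_map)
qed

lemma right_creation_fock_basis: "right_creation j *\<^sub>V fock_basis \<alpha> = fock_basis (\<alpha> @ [j])"
  by (rule Rep_ell2_inject[THEN iffD1])
    (auto simp: right_creation.rep_eq right_creation_map.rep_eq fock_basis.rep_eq fun_eq_iff)

lemma cinner_fock_basis: "cinner f (fock_basis \<alpha>) = Rep_ell2 f \<alpha>"
proof (rule has_sum_unique[OF cinner_ell2_has_sum])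
  show "((\<lambda>\<beta>. cinner (Rep_ell2 f \<beta>) (Rep_ell2 (fock_basis \<alpha>) \<beta>)) has_sum Rep_ell2 f \<alpha>) UNIV"
    by (rule has_sum_finite_neutralI[where B = "{\<alpha>}"])
      (auto simp: fock_basis.rep_eq cinner_complex_def)
qed

lemma adj_right_creation_Nil: "adj (right_creation j) *\<^sub>V fock_basis [] = 0"
  by (rule cinner_ext_right)
    (simp add: cinner_fock_basis right_creation.rep_eq right_creation_map.rep_eq flip: cinner_adj)

lemma adj_right_creation_snoc:
  "adj (right_creation j) *\<^sub>V fock_basis (\<gamma> @ [j']) = (if j = j' then fock_basis \<gamma> else 0)"
  by (rule cinner_ext_right)
    (simp add: cinner_fock_basis right_creation.rep_eq right_creation_map.rep_eq flip: cinner_adj)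

text \<open>Adding a letter in front and adding one at the end do not interfere; on words of length
  at most one both sides vanish.\<close>

lemma creation_commutant: "creation i \<in> commutant (right_creation j)"
  unfolding commutant_iff
  by (intro allI, rule Rep_ell2_inject[THEN iffD1])
    (auto simp: creation.rep_eq creation_map.rep_eq right_creation.rep_eq
      right_creation_map.rep_eq fun_eq_iff split: list.splits)

lemma nc_toeplitz_subset_commutant: "nc_toeplitz \<subseteq> commutant (right_creation j)"
  unfolding nc_toeplitz_def
  by (rule wot_closed_algebra_subset_commutant)
    (auto simp: creation_commutant, simp add: commutant_iff id_op.rep_eq)

text \<open>The inclusion is carried from elementary tensors through linear combinations and the
  norm closure to the generated algebra.\<close>

lemma nc_toeplitz_tensor_subset_commutant:
  "(nc_toeplitz_tensor :: ('n fock, 'h::chilbert_space) htensor operator set)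
    \<subseteq> commutant (right_creation j \<otimes>\<^sub>o id_op)" (is "_ \<subseteq> ?C")
  unfolding nc_toeplitz_tensor_def spatial_tensor_def
proof (intro wot_closed_algebra_subset_commutant closure_minimal closed_commutant subsetI)
  fix Z :: "('n fock, 'h) htensor operator"
  assume "Z \<in> module.span scaleC {X \<otimes>\<^sub>o Y | X Y. X \<in> nc_toeplitz \<and> Y \<in> UNIV}"
  then show "Z \<in> ?C"
  proof (induction rule: cblinfun_vector.span_induct_alt)
    case base
    then show ?case
      using op_subalgebra_commutant by (auto simp: op_subalgebra_def)
  next
    case (step c Z' Z)
    then obtain X :: "'n fock operator" and Y :: "'h operator"
      where "Z' = X \<otimes>\<^sub>o Y" "X \<in> nc_toeplitz"
      by blast
    moreover from this have "X \<bullet>\<^sub>o right_creation j = right_creation j \<bullet>\<^sub>o X"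
      using nc_toeplitz_subset_commutant[THEN subsetD, of X j] by (simp add: commutant_def)
    ultimately have "Z' \<in> ?C"
      by (simp add: commutant_def tensor_op_comp)
    with step show ?case
      using op_subalgebra_commutant[of "right_creation j \<otimes>\<^sub>o id_op"]
      by (auto simp: op_subalgebra_def)
  qed
qed

subsection \<open>The matrix of a multi-analytic operator\<close>

text \<open>Commutation lets the last letter of a basis word pass through \<open>F\<close>;
  iterating this, \<open>F\<close> is determined by its values on 1 \<otimes> h.\<close>

lemma nc_toeplitz_tensor_apply_snoc:
  assumes "F \<in> nc_toeplitz_tensor"
  shows "F *\<^sub>V fock_basis (\<beta> @ [j]) \<otimes>\<^sub>v h = (right_creation j \<otimes>\<^sub>o id_op) *\<^sub>V F *\<^sub>V fock_basis \<beta> \<otimes>\<^sub>v h"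
proof -
  have "F \<in> commutant (right_creation j \<otimes>\<^sub>o id_op)"
    by (rule subsetD[OF nc_toeplitz_tensor_subset_commutant assms])
  then have "F *\<^sub>V (right_creation j \<otimes>\<^sub>o id_op) *\<^sub>V fock_basis \<beta> \<otimes>\<^sub>v h
      = (right_creation j \<otimes>\<^sub>o id_op) *\<^sub>V F *\<^sub>V fock_basis \<beta> \<otimes>\<^sub>v h"
    unfolding commutant_iff by blast
  then show ?thesis
    by (simp add: tensor_op_apply right_creation_fock_basis id_op.rep_eq)
qed

text \<open>The values of \<open>F\<close> here lie in the range of a right creation operator, which
  is orthogonal to the vacuum.\<close>

lemma cinner_nc_toeplitz_tensor_Nil:
  assumes "F \<in> nc_toeplitz_tensor" "\<beta> \<noteq> []"
  shows "cinner (F *\<^sub>V fock_basis \<beta> \<otimes>\<^sub>v h) (fock_basis [] \<otimes>\<^sub>v h') = 0"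
  using assms(2)
  by (cases \<beta> rule: rev_cases)
    (simp_all add: nc_toeplitz_tensor_apply_snoc[OF assms(1)] cinner_adj adj_tensor_op
      tensor_op_apply adj_right_creation_Nil)

text \<open>Last letters are removed from both words together, giving 0 at the first mismatch. Equal
  lengths ensure that both words run out at once, leaving the coefficient of the empty word.\<close>

lemma cinner_nc_toeplitz_tensor_diagonal:
  assumes "F \<in> nc_toeplitz_tensor" "fourier_coefficients F A" "length \<beta> = length \<gamma>"
  shows "cinner (F *\<^sub>V fock_basis \<beta> \<otimes>\<^sub>v h) (fock_basis \<gamma> \<otimes>\<^sub>v h')
    = (if \<beta> = \<gamma> then cinner (A [] *\<^sub>V h) h' else 0)"
  using assms(3)
proof (induction \<beta> arbitrary: \<gamma> rule: rev_induct)
  case Nil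
  then show ?case
    using assms(2) by (simp add: fourier_coefficients_def)
next
  case (snoc j \<beta>)
  then obtain \<gamma>' j' where \<gamma>: "\<gamma> = \<gamma>' @ [j']" "length \<beta> = length \<gamma>'"
    by (cases \<gamma> rule: rev_cases) auto
  show ?case
    unfolding \<gamma>(1) nc_toeplitz_tensor_apply_snoc[OF assms(1)]
      cinner_adj[of "right_creation j \<otimes>\<^sub>o id_op"] adj_tensor_op tensor_op_apply
      adj_right_creation_snoc
    using snoc.IH[OF \<gamma>(2)] by (auto simp: id_op.rep_eq)
qed

section \<open>Consequences of the bound on the real part\<close>

lemma Re_cinner_le_of_Re_op_le_id:
  assumes "Re_op F \<le>\<^sub>o id_op"
  shows "Re (cinner (F *\<^sub>V u) u) \<le> (norm u)\<^sup>2"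
proof -
  have "0 \<le> Re (cinner ((id_op - Re_op F) *\<^sub>V u) u)"
    using assms by (simp add: op_le_def positive_op_def)
  \<comment> \<open>The quadratic forms of \<open>F\<close> and its adjoint are complex
    conjugates.\<close>
  moreover have "Re (cinner (Re_op F *\<^sub>V u) u) = Re (cinner (F *\<^sub>V u) u)"
    using arg_cong[OF cinner_commute[of u "F *\<^sub>V u"], of Re]
    by (simp add: Re_op_def scaleC_cblinfun.rep_eq plus_cblinfun.rep_eq cinner_add_left
        cinner_adj_left)
  ultimately show ?thesis
    by (simp add: minus_cblinfun.rep_eq id_op.rep_eq cinner_diff_left cinner_self del: of_real_power)
qed

text \<open>On words of length 0 and \<open>k\<close>, the matrix of \<open>F\<close> is lower
  triangular with diagonal \<open>A []\<close> and first column \<open>A \<alpha>\<close>. The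
  diagonal of the identity minus \<open>F\<close> produces the norm on the right.\<close>

lemma sum_Re_cinner_coefficient_le:
  fixes F :: "('n::finite fock, 'h::chilbert_space) htensor operator"
  assumes F: "F \<in> nc_toeplitz_tensor" "fourier_coefficients F A" "Re_op F \<le>\<^sub>o id_op"
    and "k \<ge> 1"
  shows "(\<Sum>\<alpha> | length \<alpha> = k. Re (cinner (A \<alpha> *\<^sub>V h) (x \<alpha>)))
    \<le> norm (id_op - A []) * ((norm h)\<^sup>2 + (\<Sum>\<alpha> | length \<alpha> = k. (norm (x \<alpha>))\<^sup>2))"
proof -
  let ?I = "{\<alpha> :: 'n list. length \<alpha> = k}"
  define v where "v = (\<Sum>\<alpha>\<in>?I. fock_basis \<alpha> \<otimes>\<^sub>v x \<alpha>)"
  define w where "w = fock_basis [] \<otimes>\<^sub>v h + v"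
  have fin: "finite ?I"
    using finite_lists_length_eq[of "UNIV :: 'n set" k] by simp
  have Nil: "[] \<notin> ?I"
    using \<open>k \<ge> 1\<close> by auto
  have basis: "cinner (fock_basis \<alpha>) (fock_basis \<beta>) = (if \<alpha> = \<beta> then 1 else 0)"
    for \<alpha> \<beta> :: "'n list"
    by (simp add: cinner_fock_basis fock_basis.rep_eq)
  have "cinner (F *\<^sub>V w) w = cinner (A [] *\<^sub>V h) h
      + (\<Sum>\<alpha>\<in>?I. cinner (A \<alpha> *\<^sub>V h) (x \<alpha>)) + (\<Sum>\<alpha>\<in>?I. cinner (A [] *\<^sub>V x \<alpha>) (x \<alpha>))"
  proof -
    have Fv: "F *\<^sub>V v = (\<Sum>\<alpha>\<in>?I. F *\<^sub>V fock_basis \<alpha> \<otimes>\<^sub>v x \<alpha>)"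
      unfolding v_def by (rule linear_sum[OF bounded_linear.linear[OF bounded_linear_cblinfun_apply]])
    \<comment> \<open>Since \<open>k \<ge> 1\<close>, no word in \<open>v\<close> is empty, and the
      upper corner vanishes.\<close>
    have "cinner (F *\<^sub>V v) (fock_basis [] \<otimes>\<^sub>v h) = 0"
      unfolding Fv cinner_sum_left
      by (rule sum.neutral) (use Nil in \<open>auto intro: cinner_nc_toeplitz_tensor_Nil[OF F(1)]\<close>)
    moreover have "cinner (F *\<^sub>V fock_basis [] \<otimes>\<^sub>v h) v = (\<Sum>\<alpha>\<in>?I. cinner (A \<alpha> *\<^sub>V h) (x \<alpha>))"
      using F(2) by (simp add: v_def cinner_sum_right fourier_coefficients_def)
    moreover have "cinner (F *\<^sub>V fock_basis [] \<otimes>\<^sub>v h) (fock_basis [] \<otimes>\<^sub>v h) = cinner (A [] *\<^sub>V h) h"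
      using F(2) by (simp add: fourier_coefficients_def)
    moreover have "cinner (F *\<^sub>V v) v = (\<Sum>\<alpha>\<in>?I. cinner (A [] *\<^sub>V x \<alpha>) (x \<alpha>))"
    proof -
      have "cinner (F *\<^sub>V v) v
          = (\<Sum>\<beta>\<in>?I. \<Sum>\<alpha>\<in>?I. if \<alpha> = \<beta> then cinner (A [] *\<^sub>V x \<alpha>) (x \<alpha>) else 0)"
        unfolding Fv unfolding v_def cinner_sum_left cinner_sum_right
        by (intro sum.cong refl) (auto simp: cinner_nc_toeplitz_tensor_diagonal[OF F(1,2)])
      then show ?thesis
        using fin by simp
    qed
    ultimately show ?thesis
      by (simp add: w_def cblinfun_apply_add cinner_add_left cinner_add_right)
  qed
  \<comment> \<open>Pythagoras for the mutually orthogonal summands of \<open>w\<close>.\<close>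
  moreover have "complex_of_real ((norm w)\<^sup>2)
      = complex_of_real ((norm h)\<^sup>2 + (\<Sum>\<alpha>\<in>?I. (norm (x \<alpha>))\<^sup>2))"
  proof -
    have "cinner v v = (\<Sum>\<beta>\<in>?I. \<Sum>\<alpha>\<in>?I. if \<alpha> = \<beta> then cinner (x \<alpha>) (x \<alpha>) else 0)"
      unfolding v_def cinner_sum_left cinner_sum_right
      by (intro sum.cong refl) (auto simp: cinner_tensor_vec basis)
    moreover have "cinner (fock_basis [] \<otimes>\<^sub>v h) v = 0" "cinner v (fock_basis [] \<otimes>\<^sub>v h) = 0"
      unfolding v_def cinner_sum_left cinner_sum_right
      by (rule sum.neutral, use Nil in \<open>auto simp: cinner_tensor_vec basis\<close>)+
    ultimately have "cinner w w = cinner h h + (\<Sum>\<alpha>\<in>?I. cinner (x \<alpha>) (x \<alpha>))"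
      using fin by (simp add: w_def cinner_add_left cinner_add_right cinner_tensor_vec basis)
    then show ?thesis
      by (simp add: cinner_self)
  qed
  then have "(norm w)\<^sup>2 = (norm h)\<^sup>2 + (\<Sum>\<alpha>\<in>?I. (norm (x \<alpha>))\<^sup>2)"
    unfolding of_real_eq_iff .
  ultimately have main: "Re (cinner (A [] *\<^sub>V h) h) + (\<Sum>\<alpha>\<in>?I. Re (cinner (A \<alpha> *\<^sub>V h) (x \<alpha>)))
      + (\<Sum>\<alpha>\<in>?I. Re (cinner (A [] *\<^sub>V x \<alpha>) (x \<alpha>)))
      \<le> (norm h)\<^sup>2 + (\<Sum>\<alpha>\<in>?I. (norm (x \<alpha>))\<^sup>2)"
    using Re_cinner_le_of_Re_op_le_id[OF F(3), of w] by simp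
  \<comment> \<open>Absorbs the diagonal terms of \<open>main\<close>, once for \<open>h\<close> and
    once for each \<open>x \<alpha>\<close>.\<close>
  have B: "(norm y)\<^sup>2 - Re (cinner (A [] *\<^sub>V y) y) \<le> norm (id_op - A []) * (norm y)\<^sup>2" for y
  proof -
    have "(norm y)\<^sup>2 - Re (cinner (A [] *\<^sub>V y) y) = Re (cinner ((id_op - A []) *\<^sub>V y) y)"
      by (simp add: minus_cblinfun.rep_eq id_op.rep_eq cinner_diff_left cinner_self del: of_real_power)
    also have "\<dots> \<le> norm (id_op - A []) * norm y * norm y"
      by (rule order_trans[OF complex_Re_le_cmod cmod_cinner_cblinfun_le])
    finally show ?thesis
      by (simp add: power2_eq_square mult.assoc)
  qed
  have "(\<Sum>\<alpha>\<in>?I. (norm (x \<alpha>))\<^sup>2 - Re (cinner (A [] *\<^sub>V x \<alpha>) (x \<alpha>)))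
      \<le> (\<Sum>\<alpha>\<in>?I. norm (id_op - A []) * (norm (x \<alpha>))\<^sup>2)"
    by (intro sum_mono B)
  then show ?thesis
    using main B[of h] by (simp add: sum_subtractf sum_distrib_left distrib_left)
qed

lemma norm_column_coefficient_le:
  fixes F :: "('n::finite fock, 'h::chilbert_space) htensor operator"
  assumes F: "F \<in> nc_toeplitz_tensor" "fourier_coefficients F A" "Re_op F \<le>\<^sub>o id_op"
    and "k \<ge> 1"
  shows "norm (\<Sum>\<alpha> | length \<alpha> = k. adj (A \<alpha>) \<bullet>\<^sub>o A \<alpha>) \<le> (2 * norm (id_op - A []))\<^sup>2"
proof (rule norm_column_le)
  fix h
  define b where "b = norm (id_op - A [])"
  define s where "s = (\<Sum>\<alpha> | length \<alpha> = k. (norm (A \<alpha> *\<^sub>V h))\<^sup>2)"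
  \<comment> \<open>With \<open>x \<alpha>\<close> equal to \<open>t\<close> times the image of
    \<open>h\<close> under \<open>A \<alpha>\<close>, the estimate becomes quadratic in
    \<open>t\<close>.\<close>
  have le: "t * s \<le> b * ((norm h)\<^sup>2 + t\<^sup>2 * s)" for t
    using sum_Re_cinner_coefficient_le[OF assms, of h "\<lambda>\<alpha>. complex_of_real t *\<^sub>C (A \<alpha> *\<^sub>V h)"]
    by (simp add: b_def s_def cinner_self power_mult_distrib sum_distrib_left del: of_real_power)
  have "s \<le> (2 * b)\<^sup>2 * (norm h)\<^sup>2"
  proof (cases "b = 0")
    case True
    then show ?thesis
      \<comment> \<open>For \<open>b = 0\<close> this reads \<open>s \<le> 0\<close>.\<close>
      using le[of 1] by simp
  next
    case False
    then have "b > 0"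
      by (simp add: b_def)
    then show ?thesis
      \<comment> \<open>This value of \<open>t\<close> maximises t - b t^2, the factor of
        \<open>s\<close> after rearranging.\<close>
      using le[of "1 / (2 * b)"] by (simp add: field_simps power2_eq_square)
  qed
  then show "(\<Sum>\<alpha> | length \<alpha> = k. (norm (A \<alpha> *\<^sub>V h))\<^sup>2) \<le> (2 * norm (id_op - A []))\<^sup>2 * (norm h)\<^sup>2"
    by (simp add: s_def b_def)
qed simp

theorem mainTheorem11:
  fixes F :: "('n::finite fock, 'h::chilbert_space) htensor operator"
    and A :: "'n list \<Rightarrow> 'h operator"
  assumes "F \<in> nc_toeplitz_tensor"
    and "fourier_coefficients F A"
    and "positive_op (A [])"
    and "Re_op F \<le>\<^sub>o id_op"
  shows "(\<forall>k\<ge>1. sqrt (norm (\<Sum>\<alpha> | length \<alpha> = k. adj (A \<alpha>) \<bullet>\<^sub>o A \<alpha>)) \<le> 2 * norm (id_op - A [])) \<and>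
    (\<forall>T :: 'n \<Rightarrow> 'k::chilbert_space operator.
      sqrt (norm (\<Sum>i\<in>UNIV. T i \<bullet>\<^sub>o adj (T i))) \<le> 1 / 3 \<longrightarrow>
      summable (\<lambda>k. norm (\<Sum>\<alpha> | length \<alpha> = k. word_op T \<alpha> \<otimes>\<^sub>o A \<alpha>)) \<and>
      (\<Sum>k. norm (\<Sum>\<alpha> | length \<alpha> = k. word_op T \<alpha> \<otimes>\<^sub>o A \<alpha>))
        \<le> norm (A []) + norm (id_op - A []))"
proof (intro conjI allI impI)
  let ?b = "norm (id_op - A [])"
  show column: "sqrt (norm (\<Sum>\<alpha> | length \<alpha> = k. adj (A \<alpha>) \<bullet>\<^sub>o A \<alpha>)) \<le> 2 * ?b" if "k \<ge> 1" for k
    using norm_column_coefficient_le[OF assms(1,2,4) that] by (intro real_le_lsqrt) simp_all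
  fix T :: "'n \<Rightarrow> 'k operator"
  assume T: "sqrt (norm (\<Sum>i\<in>UNIV. T i \<bullet>\<^sub>o adj (T i))) \<le> 1 / 3"
  define a where "a k = norm (\<Sum>\<alpha> | length \<alpha> = k. word_op T \<alpha> \<otimes>\<^sub>o A \<alpha>)" for k
  \<comment> \<open>A summable majorant. The index 0 is separate because the column bound starts at
    \<open>k = 1\<close>.\<close>
  define g where "g k = (if k = 0 then norm (A []) else 2 * ?b * (1 / 3) ^ k)" for k :: nat
  have row: "sqrt (norm (\<Sum>\<alpha> | length \<alpha> = k. word_op T \<alpha> \<bullet>\<^sub>o adj (word_op T \<alpha>))) \<le> (1 / 3) ^ k" for k
  proof -
    have "sqrt (norm (\<Sum>\<alpha> | length \<alpha> = k. word_op T \<alpha> \<bullet>\<^sub>o adj (word_op T \<alpha>)))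
        \<le> sqrt (norm (\<Sum>i\<in>UNIV. T i \<bullet>\<^sub>o adj (T i))) ^ k"
      using real_sqrt_le_mono[OF norm_row_word_op_le[of T k]] by (simp add: real_sqrt_power)
    also have "\<dots> \<le> (1 / 3) ^ k"
      by (rule power_mono[OF T]) simp
    finally show ?thesis .
  qed
  have le: "a k \<le> g k" for k
  proof (cases "k = 0")
    case True
    have "norm ((id_op :: 'k operator) \<otimes>\<^sub>o A []) \<le> norm (A [])"
      using norm_tensor_op_le[of "id_op :: 'k operator" "A []"]
        mult_right_mono[OF norm_id_op_le[where 'a = 'k], of "norm (A [])"] by simp
    with True show ?thesis
      by (simp add: a_def g_def)
  next
    case False
    \<comment> \<open>Row times column: the words in \<open>T\<close> contribute the power of 1/3
      and the coefficients the factor \<open>2 * ?b\<close>.\<close>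
    have "a k \<le> (1 / 3) ^ k * (2 * ?b)"
      unfolding a_def using False
      by (intro order_trans[OF norm_sum_tensor_op_le] mult_mono row column) simp_all
    with False show ?thesis
      by (simp add: g_def mult_ac)
  qed
  \<comment> \<open>The shift by one leaves an extra factor 1/3, and 2 * 1/3 * 3/2 = 1 makes the
    total exactly \<open>?b\<close>.\<close>
  have "(\<lambda>k. 2 * ?b * (1 / 3) * (1 / 3) ^ k) sums (2 * ?b * (1 / 3) * (1 / (1 - 1 / 3)))"
    by (intro sums_mult geometric_sums) simp
  then have "(\<lambda>k. g (Suc k)) sums ?b"
    by (simp add: g_def mult_ac)
  then have g: "g sums (norm (A []) + ?b)"
    using sums_Suc[of g ?b] by (simp add: g_def add.commute)
  have a: "summable a"
    using le by (intro summable_comparison_test'[OF sums_summable[OF g]]) (simp add: a_def)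
  then show "summable (\<lambda>k. norm (\<Sum>\<alpha> | length \<alpha> = k. word_op T \<alpha> \<otimes>\<^sub>o A \<alpha>))"
    by (simp add: a_def[abs_def])
  have "suminf a \<le> norm (A []) + ?b"
    using suminf_le[OF le a sums_summable[OF g]] sums_unique[OF g] by simp
  then show "(\<Sum>k. norm (\<Sum>\<alpha> | length \<alpha> = k. word_op T \<alpha> \<otimes>\<^sub>o A \<alpha>)) \<le> norm (A []) + ?b"
    by (simp add: a_def[abs_def])
qed

end
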